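(* For $n>0$, the map $\Gamma$ (described in the context) restricts to a bijection from (a) the set of pairs $(\mu,\mu_{\mathrm{steep}})$, where $\mu$ is a Dyck path with $2n$ steps, to (b) the set of pairs $(\nu_{\mathrm{bounce}},\nu)$, where $\nu$ is a Dyck path with $2n$ steps. Moreover, if $(\nu_{\mathrm{bounce}},\nu)=\Gamma(\mu,\mu_{\mathrm{steep}})$, then $\nu=\zeta(\mu)$, where $\zeta$ is the zeta map from $q,t$-Catalan combinatorics.
   Context: Dyck paths. A Dyck path with $2n$ steps is a lattice path from $(0,0)$ to $(n,n)$ with steps $N=(0,1)$, $E=(1,0)$ staying weakly above the main diagonal. A valley is a lattice point on the path preceded by $E$ and followed by $N$. A Dyck path is steep if it has no two consecutive east-steps before its last north-step; it is bounce if it equals $N^{i_1}E^{i_1}\cdots N^{i_s}E^{i_s}$ for positive integers $i_1,\dots,i_s$. A pair $(\mu_1,\mu_2)$ of Dyck paths of the same length is nested if $\mu_1$ stays weakly below $\mu_2$. $\mathcal{SP}_n$ (resp. $\mathcal{BP}_n$) is the set of nested pairs of Dyck paths with $2n$ steps whose top path $\mu_2$ is steep (resp. whose bottom path $\mu_1$ is bounce). Steep and bounce path of a Dyck path $\mu$. $\mu_{\mathrm{steep}}$: start at the origin; move north (by at least one step) until the first point at which an east-step can be added while remaining weakly above $\mu$; append this east-step; repeat until a point with $y$-coordinate $n$ is reached; then add east-steps to end at $(n,n)$. $\mu_{\mathrm{bounce}}$: start at the origin; move north to the last point that is still weakly below $\mu$; move east until the main diagonal is hit; repeat until $(n,n)$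 is reached. The bounce parameters of $\mu$ are the $x$-coordinates $0=b_0<b_1<\dots<b_r=n$ of the contact points of $\mu_{\mathrm{bounce}}$ with the main diagonal. Zeta map. The area vector of a Dyck path $\mu$ with $2n$ steps is $\mathbf{a}(\mu)=(a_1,\dots,a_n)$, where $a_i$ is the number of unit boxes in row $i$ (rows numbered from the bottom) lying entirely below $\mu$ and above the main diagonal; area vectors are exactly the nonnegative integer sequences with $a_1=0$ and $a_{i+1}\le a_i+1$, and $\mu$ is determined by $\mathbf a(\mu)$. The zeta map $\zeta$ is the bijection on Dyck paths with $2n$ steps whose inverse is as follows. Let $\nu$ have bounce parameters $b_0<\dots<b_r$. For $k\in\{1,\dots,r-1\}$ let $\mathbf{a}^{(k)}$ be the sequence obtained from the subpath of $\nu$ from $(b_{k-1},b_k)$ to $(b_k,b_{k+1})$ (both points lie on $\nu$) by replacing each east-step by $k-1$ and each north-step by $k$. Then $\mathbf{a}(\zeta^{-1}(\nu))$ is the unique area vector of length $n$ having exactly $b_{k+1}-b_k$ entries equal to $k$ for $0\le k\le r-1$ and whose subsequence of entries in $\{k-1,k\}$ is $\mathbf{a}^{(k)}$ for every $k\in\{1,\dots,r-1\}$. LAC trees. A composition of $n$ is a tuple $\alpha=(\alpha_1,\dots,\alpha_r)$ of positive integers with sum $n$; $s_0=0$, $s_i=\alpha_1+\dots+\alpha_i$; $\nu_\alpha=N^{\alpha_1}E^{\alpha_1}\cdots N^{\alpha_r}E^{\alpha_r}$. In a plane rooted tree the children of each node are linearly ordered from left to right; the LR-prefix order lists nodes by first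 visit in the depth-first search from the root visiting children from left to right. An internal node is neither the root nor a leaf. Let $T$ be a plane rooted tree with $n$ non-root nodes. For $k=1,\dots,r$ perform step $k$: a non-root node is active if it is not yet colored and its parent is the root or an already colored node; if there are fewer than $\alpha_k$ active nodes, fail; otherwise give color $k$ to the first $\alpha_k$ of the active nodes (as determined at the beginning of the step) in LR-prefix order. If this never fails, $T$ is an $\alpha$-tree, with the resulting left-aligned coloring. $LAC_n$ is the set of pairs $(T,\alpha)$ with $\alpha$ a composition of $n$ and $T$ an $\alpha$-tree. Map $\Xi_{\mathrm{steep}}:LAC_n\to\mathcal{SP}_n$. Given $(T,\alpha)$, traverse $T$ by depth-first search from the root visiting children from right to left. Each time a new non-root node is visited, write $N_\bullet$ if its color has not been seen before, and $N_\circ$ otherwise; each time one returns to an already visited node (moves back up to a parent), write $E$. From the resulting word, $\mu_1$ is obtained by forgetting the marking, and $\mu_2$ is obtained by deleting all $E$, replacing each $N_\bullet$ by $N$ and each $N_\circ$ by $EN$, and appending east-steps until $(n,n)$ is reached. Put $\Xi_{\mathrm{steep}}(T,\alpha)=(\mu_1,\mu_2)$. Map $\Xi_{\mathrm{bounce}}:LAC_n\to\mathcal{BP}_n$. Given $(T,\alpha)$, let $a_k$ be the number of active nodes at the beginning of step $k+1$ of the coloring procedure. For each internal node $u$, if $u$ is the $i$-th node of color $k$ in LR-prefix order and its rightmost child is the $j$-th active node (in LR-prefix order) at the beginning of step $k+1$, mark the point $(s_k-i+1,\ s_k+a_k-j)$. Let $\mu_T$ be the unique Dyck path from $(0,0)$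 to $(n,n)$ whose valleys are exactly the marked points. Put $\Xi_{\mathrm{bounce}}(T,\alpha)=(\nu_\alpha,\mu_T)$. Both maps are bijections, and $\Gamma=\Xi_{\mathrm{bounce}}\circ\Xi_{\mathrm{steep}}^{-1}:\mathcal{SP}_n\to\mathcal{BP}_n$. *)

theory Defs
  imports Main
begin

section \<open>Lattice paths and Dyck paths\<close>

datatype step = North | East

type_synonym path = "step list"
type_synonym point = "nat \<times> nat"

definition endpoint :: "path \<Rightarrow> point" where
  "endpoint w = (count_list w East, count_list w North)"

definition points :: "path \<Rightarrow> point set" where
  "points w = {endpoint (take i w) | i. i \<le> length w}"

definition Dyck :: "nat \<Rightarrow> path set" where
  "Dyck n = {w. endpoint w = (n, n) \<and> (\<forall>(x, y) \<in> points w. x \<le> y)}"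

definition valleys :: "path \<Rightarrow> point set" where
  "valleys w = {endpoint (take (Suc i) w) | i. Suc i < length w \<and> w ! i = East \<and> w ! Suc i = North}"

text \<open>
  Position of a lattice point relative to a path; only used for points whose \<open>x\<close>-coordinate
  is attained by the path. A lattice path stays weakly above or below another one if and only if
  all its lattice points do.
\<close>

definition weakly_below :: "point \<Rightarrow> path \<Rightarrow> bool" where
  "weakly_below p w \<longleftrightarrow> (\<exists>y. (fst p, y) \<in> points w \<and> snd p \<le> y)"

definition weakly_above :: "point \<Rightarrow> path \<Rightarrow> bool" where
  "weakly_above p w \<longleftrightarrow> (\<exists>y. (fst p, y) \<in> points w \<and> y \<le> snd p)"

definition nested :: "path \<Rightarrow> path \<Rightarrow> bool" where
  "nested \<mu>\<^sub>1 \<mu>\<^sub>2 \<longleftrightarrow> (\<forall>p \<in> points \<mu>\<^sub>1. weakly_below p \<mu>\<^sub>2)"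

definition steep :: "path \<Rightarrow> bool" where
  "steep w \<longleftrightarrow>
    \<not> (\<exists>i j. Suc i < j \<and> j < length w \<and> w ! i = East \<and> w ! Suc i = East \<and> w ! j = North)"

definition composition :: "nat \<Rightarrow> nat list \<Rightarrow> bool" where
  "composition n \<alpha> \<longleftrightarrow> (\<forall>a \<in> set \<alpha>. 0 < a) \<and> sum_list \<alpha> = n"

definition composition_path :: "nat list \<Rightarrow> path" where
  "composition_path \<alpha> = concat (map (\<lambda>a. replicate a North @ replicate a East) \<alpha>)"

definition bounce :: "path \<Rightarrow> bool" where
  "bounce w \<longleftrightarrow> (\<exists>\<alpha>. (\<forall>a \<in> set \<alpha>. 0 < a) \<and> w = composition_path \<alpha>)"

definition SP :: "nat \<Rightarrow> (path \<times> path) set" where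
  "SP n = {(\<mu>\<^sub>1, \<mu>\<^sub>2). \<mu>\<^sub>1 \<in> Dyck n \<and> \<mu>\<^sub>2 \<in> Dyck n \<and> nested \<mu>\<^sub>1 \<mu>\<^sub>2 \<and> steep \<mu>\<^sub>2}"

definition BP :: "nat \<Rightarrow> (path \<times> path) set" where
  "BP n = {(\<mu>\<^sub>1, \<mu>\<^sub>2). \<mu>\<^sub>1 \<in> Dyck n \<and> \<mu>\<^sub>2 \<in> Dyck n \<and> nested \<mu>\<^sub>1 \<mu>\<^sub>2 \<and> bounce \<mu>\<^sub>1}"


section \<open>Steep path and bounce path of a Dyck path\<close>

text \<open>
  \<open>steep_from n \<mu> x y\<close> continues the construction from \<open>(x, y)\<close>, where a north-step is due
  next (or, for \<open>y = n\<close>, only the final east-steps are missing).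
\<close>

function steep_from :: "nat \<Rightarrow> path \<Rightarrow> nat \<Rightarrow> nat \<Rightarrow> path" where
  "steep_from n \<mu> x y =
    (if y \<ge> n then replicate (n - x) East
     else North #
       (if weakly_above (Suc x, Suc y) \<mu>
        then East # steep_from n \<mu> (Suc x) (Suc y)
        else steep_from n \<mu> x (Suc y)))"
  by pat_completeness auto
termination
  by (relation "measure (\<lambda>(n, \<mu>, x, y). n - y)") auto

declare steep_from.simps [simp del]

definition steep_path :: "nat \<Rightarrow> path \<Rightarrow> path" where
  "steep_path n \<mu> = steep_from n \<mu> 0 0"

definition height_at :: "path \<Rightarrow> nat \<Rightarrow> nat" where
  "height_at \<mu> x = Max {y. weakly_below (x, y) \<mu>}"

text \<open>
  \<open>bounce_from n \<mu> x\<close> continues the construction from the diagonal point \<open>(x, x)\<close>. For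
  \<open>\<mu> \<in> Dyck n\<close> and \<open>x < n\<close> one always has \<open>x < height_at \<mu> x\<close>; this test only makes the
  recursion terminate for arbitrary \<open>\<mu>\<close>.
\<close>

function bounce_from :: "nat \<Rightarrow> path \<Rightarrow> nat \<Rightarrow> path" where
  "bounce_from n \<mu> x =
    (let y = height_at \<mu> x in
     if x < n \<and> x < y
     then replicate (y - x) North @ replicate (y - x) East @ bounce_from n \<mu> y
     else [])"
  by pat_completeness auto
termination
  by (relation "measure (\<lambda>(n, \<mu>, x). n - x)") auto

declare bounce_from.simps [simp del]

definition bounce_path :: "nat \<Rightarrow> path \<Rightarrow> path" where
  "bounce_path n \<mu> = bounce_from n \<mu> 0"

definition bounce_params :: "nat \<Rightarrow> path \<Rightarrow> nat list" where
  "bounce_params n \<mu> = sorted_list_of_set {x. (x, x) \<in> points (bounce_path n \<mu>)}"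


section \<open>The zeta map\<close>

text \<open>
  Entry \<open>i\<close> (counted from 0) counts the unit boxes with lower left corner \<open>(x, i)\<close> whose lower
  right corner is weakly above the diagonal and whose upper left corner is weakly below the path.
\<close>

definition area_vector :: "nat \<Rightarrow> path \<Rightarrow> nat list" where
  "area_vector n \<mu> = map (\<lambda>i. card {x. Suc x \<le> i \<and> weakly_below (x, Suc i) \<mu>}) [0..<n]"

text \<open>The point \<open>(x, y)\<close> of a path is reached after \<open>x + y\<close> steps.\<close>

definition subpath :: "path \<Rightarrow> point \<Rightarrow> point \<Rightarrow> path" where
  "subpath w p q =
    take ((fst q + snd q) - (fst p + snd p)) (drop (fst p + snd p) w)"

definition zeta_word :: "nat \<Rightarrow> path \<Rightarrow> nat \<Rightarrow> nat list" where
  "zeta_word n \<nu> k =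
    (let b = (!) (bounce_params n \<nu>) in
     map (\<lambda>s. case s of East \<Rightarrow> k - 1 | North \<Rightarrow> k)
       (subpath \<nu> (b (k - 1), b k) (b k, b (k + 1))))"

definition zeta_inv :: "nat \<Rightarrow> path \<Rightarrow> path" where
  "zeta_inv n \<nu> =
    (let b = (!) (bounce_params n \<nu>); r = length (bounce_params n \<nu>) - 1 in
     THE \<mu>. \<mu> \<in> Dyck n \<and>
       (\<forall>k < r. count_list (area_vector n \<mu>) k = b (k + 1) - b k) \<and>
       (\<forall>k. 1 \<le> k \<and> k < r \<longrightarrow>
          filter (\<lambda>a. a \<in> {k - 1, k}) (area_vector n \<mu>) = zeta_word n \<nu> k))"

definition zeta :: "nat \<Rightarrow> path \<Rightarrow> path" where
  "zeta n = the_inv_into (Dyck n) (zeta_inv n)"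


section \<open>Plane trees and left-aligned colorings\<close>

datatype ptree = Node (children: "ptree list")

text \<open>
  A node is addressed by the list of child indices (0 being the leftmost child) leading to it
  from the root; so the root is \<open>[]\<close> and the parent of \<open>u \<noteq> []\<close> is \<open>butlast u\<close>.
\<close>

type_synonym node = "nat list"

fun subtree :: "ptree \<Rightarrow> node \<Rightarrow> ptree" where
  "subtree T [] = T"
| "subtree T (i # u) = subtree (children T ! i) u"

primrec lr_prefix :: "ptree \<Rightarrow> node list" where
  "lr_prefix (Node ts) =
    [] # concat (map2 (\<lambda>i us. map ((#) i) us) [0..<length ts] (map lr_prefix ts))"

definition nonroot_nodes :: "ptree \<Rightarrow> node list" where
  "nonroot_nodes T = filter (\<lambda>u. u \<noteq> []) (lr_prefix T)"

definition internal :: "ptree \<Rightarrow> node \<Rightarrow> bool" where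
  "internal T u \<longleftrightarrow> u \<in> set (nonroot_nodes T) \<and> children (subtree T u) \<noteq> []"

definition rightmost_child :: "ptree \<Rightarrow> node \<Rightarrow> node" where
  "rightmost_child T u = u @ [length (children (subtree T u)) - 1]"

definition active :: "ptree \<Rightarrow> (node \<rightharpoonup> nat) \<Rightarrow> node list" where
  "active T c =
    filter (\<lambda>u. u \<notin> dom c \<and> (butlast u = [] \<or> butlast u \<in> dom c)) (nonroot_nodes T)"

text \<open>
  \<open>coloring T \<alpha> k\<close> is the partial coloring after the first \<open>k\<close> steps. Colors are \<open>1, 2, \<dots>\<close>,
  whereas the parts of \<open>\<alpha>\<close> are indexed from 0.
\<close>

primrec coloring :: "ptree \<Rightarrow> nat list \<Rightarrow> nat \<Rightarrow> (node \<rightharpoonup> nat)" where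
  "coloring T \<alpha> 0 = Map.empty"
| "coloring T \<alpha> (Suc k) =
    (\<lambda>u. if u \<in> set (take (\<alpha> ! k) (active T (coloring T \<alpha> k))) then Some (Suc k)
         else coloring T \<alpha> k u)"

definition is_alpha_tree :: "nat list \<Rightarrow> ptree \<Rightarrow> bool" where
  "is_alpha_tree \<alpha> T \<longleftrightarrow>
    length (nonroot_nodes T) = sum_list \<alpha> \<and>
    (\<forall>k < length \<alpha>. \<alpha> ! k \<le> length (active T (coloring T \<alpha> k)))"

definition LAC :: "nat \<Rightarrow> (ptree \<times> nat list) set" where
  "LAC n = {(T, \<alpha>). composition n \<alpha> \<and> is_alpha_tree \<alpha> T}"

definition color :: "ptree \<Rightarrow> nat list \<Rightarrow> node \<Rightarrow> nat" where
  "color T \<alpha> u = the (coloring T \<alpha> (length \<alpha>) u)"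


section \<open>The map to steep pairs\<close>

datatype 'v event = Visit 'v | Return

text \<open>
  The depth-first search visiting children from right to left: first visits of non-root nodes
  and moves from a node back to its parent.
\<close>

primrec rl_walk :: "ptree \<Rightarrow> node event list" where
  "rl_walk (Node ts) =
    concat (rev (map2 (\<lambda>i w. Visit [i] # map (map_event ((#) i)) w @ [Return])
      [0..<length ts] (map rl_walk ts)))"

datatype marked_step = North_bullet | North_circ | East_plain

fun mark_walk :: "(node \<Rightarrow> nat) \<Rightarrow> nat set \<Rightarrow> node event list \<Rightarrow> marked_step list" where
  "mark_walk c seen [] = []"
| "mark_walk c seen (Return # w) = East_plain # mark_walk c seen w"
| "mark_walk c seen (Visit u # w) =
    (if c u \<in> seen then North_circ else North_bullet) # mark_walk c (insert (c u) seen) w"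

definition forget_marks :: "marked_step list \<Rightarrow> path" where
  "forget_marks =
    map (\<lambda>s. case s of North_bullet \<Rightarrow> North | North_circ \<Rightarrow> North | East_plain \<Rightarrow> East)"

definition expand_marks :: "marked_step list \<Rightarrow> path" where
  "expand_marks w =
    concat (map (\<lambda>s. case s of
      North_bullet \<Rightarrow> [North] | North_circ \<Rightarrow> [East, North] | East_plain \<Rightarrow> []) w)"

definition Xi_steep :: "ptree \<times> nat list \<Rightarrow> path \<times> path" where
  "Xi_steep = (\<lambda>(T, \<alpha>).
    let n = length (nonroot_nodes T);
        w = mark_walk (color T \<alpha>) {} (rl_walk T);
        v = expand_marks w
    in (forget_marks w, v @ replicate (n - count_list v East) East))"


section \<open>The map to bounce pairs\<close>

definition color_class :: "ptree \<Rightarrow> nat list \<Rightarrow> nat \<Rightarrow> node list" where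
  "color_class T \<alpha> k = filter (\<lambda>u. color T \<alpha> u = k) (nonroot_nodes T)"

text \<open>The active nodes at the beginning of step \<open>k + 1\<close>.\<close>

definition active_after :: "ptree \<Rightarrow> nat list \<Rightarrow> nat \<Rightarrow> node list" where
  "active_after T \<alpha> k = active T (coloring T \<alpha> k)"

text \<open>\<open>is_nth xs i x\<close>: the \<open>i\<close>-th entry of \<open>xs\<close>, counted from 1, is \<open>x\<close>.\<close>

definition is_nth :: "'a list \<Rightarrow> nat \<Rightarrow> 'a \<Rightarrow> bool" where
  "is_nth xs i x \<longleftrightarrow> 1 \<le> i \<and> i \<le> length xs \<and> xs ! (i - 1) = x"

text \<open>The subtractions do not truncate, since \<open>1 \<le> i \<le> s\<^sub>k\<close> and \<open>j \<le> a\<^sub>k\<close>.\<close>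

definition marked_points :: "ptree \<Rightarrow> nat list \<Rightarrow> point set" where
  "marked_points T \<alpha> =
    {(sum_list (take k \<alpha>) - i + 1, sum_list (take k \<alpha>) + length (active_after T \<alpha> k) - j)
     | u k i j. internal T u \<and> color T \<alpha> u = k
         \<and> is_nth (color_class T \<alpha> k) i u
         \<and> is_nth (active_after T \<alpha> k) j (rightmost_child T u)}"

definition Xi_bounce :: "ptree \<times> nat list \<Rightarrow> path \<times> path" where
  "Xi_bounce = (\<lambda>(T, \<alpha>).
    (composition_path \<alpha>,
     THE \<mu>. \<mu> \<in> Dyck (length (nonroot_nodes T)) \<and> valleys \<mu> = marked_points T \<alpha>))"

definition Gamma :: "nat \<Rightarrow> path \<times> path \<Rightarrow> path \<times> path" where
  "Gamma n = Xi_bounce \<circ> the_inv_into (LAC n) Xi_steep"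

end

theory Submission
  imports Defs
begin

text \<open>
  Reading a tree from right to left codes it as a Dyck path \<open>\<mu>\<close>, whose area vector lists the
  depths of the nodes minus one. The pair \<open>(\<mu>, \<mu>\<^sub>s\<^sub>t\<^sub>e\<^sub>e\<^sub>p)\<close> belongs to the coloring of that tree in which
  every active node is colored at every step, so that colors are depths: the marked north-steps are
  then those at which the maximal depth increases. For this coloring, the second path of the bounce
  pair is obtained by concatenating, for \<open>k = 1, 2, \<dots>\<close>, the right-to-left lists of the nodes of
  depths \<open>k\<close> and \<open>k + 1\<close>, with depth \<open>k\<close> read as east and depth \<open>k + 1\<close> read as north. Its bounce
  parameters are the partial sums of the level sizes, and its pieces are exactly the words from which
  \<open>\<zeta>\<^sup>-\<^sup>1\<close> reconstructs the area vector of \<open>\<mu>\<close>. Bijectivity follows since there are only finitely many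
  Dyck paths.
\<close>

section \<open>Paths and their east counts\<close>

text \<open>One property of the right-to-left order drives all parts: from a node to the next one
  the depth rises by at most one, and it rises only when passing from an internal node to its
  rightmost child. It decides when the steep path takes an east-step, makes every level word begin
  with an east-step (which fixes the bounce path), identifies the valleys, and lets a list of depths
  be recovered from its restrictions to two consecutive values. The obstacle is that
  \<open>Gamma\<close> and \<open>zeta\<close> are built on \<open>the_inv_into\<close>, a definite
  description. For \<open>Gamma\<close> the whole fibre of \<open>Xi_steep\<close> over a pair of a
  path and its steep path is computed; for \<open>zeta\<close> the inverse is evaluated on the paths
  of consecutive levels, which turn out to be all Dyck paths. The coloring and the marked points use
  the left-to-right order, while the words use the opposite one. The two orders are reconciled one
  level at a time, where they are reverses of each other. Geometric conditions on paths become
  inequalities between lists of east counts.\<close>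

abbreviation easts :: "path \<Rightarrow> nat" where "easts w \<equiv> count_list w East"
abbreviation norths :: "path \<Rightarrow> nat" where "norths w \<equiv> count_list w North"

lemma points_iff: "(x, y) \<in> points w \<longleftrightarrow> (\<exists>p s. w = p @ s \<and> easts p = x \<and> norths p = y)"
proof
  assume "(x, y) \<in> points w"
  then obtain i where "endpoint (take i w) = (x, y)"
    by (auto simp: points_def)
  then show "\<exists>p s. w = p @ s \<and> easts p = x \<and> norths p = y"
    by (intro exI[of _ "take i w"] exI[of _ "drop i w"]) (auto simp: endpoint_def)
next
  assume "\<exists>p s. w = p @ s \<and> easts p = x \<and> norths p = y"
  then obtain p s where "w = p @ s" "easts p = x" "norths p = y"
    by blast
  then show "(x, y) \<in> points w"
    by (auto simp: points_def endpoint_def intro!: exI[of _ "length p"])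
qed

lemma valleys_iff:
  "(x, y) \<in> valleys w \<longleftrightarrow> (\<exists>p s. w = p @ East # North # s \<and> x = Suc (easts p) \<and> y = norths p)"
proof
  assume "(x, y) \<in> valleys w"
  then obtain i where i: "Suc i < length w" "w ! i = East" "w ! Suc i = North"
    "endpoint (take (Suc i) w) = (x, y)"
    by (auto simp: valleys_def)
  have "w = take i w @ East # North # drop (Suc (Suc i)) w"
    using i by (metis Cons_nth_drop_Suc Suc_lessD append_take_drop_id)
  moreover have "x = Suc (easts (take i w))" "y = norths (take i w)"
    using i by (auto simp: take_Suc_conv_app_nth endpoint_def)
  ultimately show "\<exists>p s. w = p @ East # North # s \<and> x = Suc (easts p) \<and> y = norths p"
    by blast
next
  assume "\<exists>p s. w = p @ East # North # s \<and> x = Suc (easts p) \<and> y = norths p"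
  then obtain p s where "w = p @ East # North # s" "x = Suc (easts p)" "y = norths p"
    by blast
  then show "(x, y) \<in> valleys w"
    by (auto simp: valleys_def endpoint_def nth_append intro!: exI[of _ "length p"])
qed

lemma count_replicate_step [simp]:
  "easts (replicate m East) = m" "easts (replicate m North) = 0"
  "norths (replicate m East) = 0" "norths (replicate m North) = m"
  by (induction m) auto

lemma length_eq_easts_norths: "length w = easts w + norths w"
proof (induction w)
  case (Cons s w)
  then show ?case
    by (cases s) auto
qed simp

text \<open>
  The entry at index \<open>i\<close> of \<open>east_counts c w\<close> is \<open>c\<close> plus the number of east-steps of \<open>w\<close> before
  its \<open>(i + 1)\<close>-st north-step.
\<close>

fun east_counts :: "nat \<Rightarrow> path \<Rightarrow> nat list" where
  "east_counts c [] = []"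
| "east_counts c (North # w) = c # east_counts c w"
| "east_counts c (East # w) = east_counts (Suc c) w"

lemma east_counts_append: "east_counts c (u @ v) = east_counts c u @ east_counts (c + easts u) v"
  by (induction c u rule: east_counts.induct) auto

lemma length_east_counts [simp]: "length (east_counts c w) = norths w"
  by (induction c w rule: east_counts.induct) auto

lemma east_counts_ge: "x \<in> set (east_counts c w) \<Longrightarrow> c \<le> x"
  by (induction c w rule: east_counts.induct) auto

lemma east_counts_Suc_neq: "east_counts (Suc c) w \<noteq> c # cs"
proof
  assume "east_counts (Suc c) w = c # cs"
  then show False
    using east_counts_ge[of c "Suc c" w] by simp
qed

text \<open>East-steps after the last north-step leave no trace in \<open>east_counts\<close>, so
  their total number has to agree as well. Where one path goes north and the other east, one list
  starts with \<open>c\<close> and the other has only entries above \<open>c\<close>.\<close>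

lemma east_counts_inj: "east_counts c u = east_counts c v \<Longrightarrow> easts u = easts v \<Longrightarrow> u = v"
proof (induction u arbitrary: c v)
  case Nil
  then have "norths v = 0" "easts v = 0"
    by (metis count_list.simps(1) length_east_counts, simp)
  then show ?case
    using length_eq_easts_norths[of v] by simp
next
  case (Cons r u)
  show ?case
  proof (cases v)
    case Nil
    then show ?thesis
      using Cons.prems by (cases r) auto
  next
    case v: (Cons s v')
    show ?thesis
      using Cons.prems Cons.IH[of _ v'] east_counts_Suc_neq[of c] east_counts_Suc_neq[of c, symmetric]
      unfolding v by (cases r; cases s) auto
  qed
qed

lemma nth_east_counts: "east_counts 0 (p @ North # s) ! norths p = easts p"
  by (simp add: east_counts_append nth_append)

section \<open>Position of points relative to a path\<close>

lemma ex_split_at_north: "i < norths w \<Longrightarrow> \<exists>p s. w = p @ North # s \<and> norths p = i"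
proof (induction w rule: rev_induct)
  case (snoc a w)
  show ?case
  proof (cases "i < norths w")
    case True
    then show ?thesis
      using snoc.IH by fastforce
  next
    case False
    then have "a = North" "norths w = i"
      using snoc.prems by (auto split: if_splits)
    then show ?thesis
      by blast
  qed
qed simp

lemma split_at_north:
  assumes "i < norths w"
  obtains p s where "w = p @ North # s" "norths p = i" "easts p = east_counts 0 w ! i"
  using ex_split_at_north[OF assms] nth_east_counts by metis

lemma ex_prefix_easts: "x \<le> easts w \<Longrightarrow> \<exists>p s. w = p @ s \<and> easts p = x"
proof (induction w rule: rev_induct)
  case (snoc a w)
  show ?case
  proof (cases "x \<le> easts w")
    case True
    then show ?thesis
      using snoc.IH by fastforce
  next
    case False
    then have "easts (w @ [a]) = x"
      using snoc.prems by (auto split: if_splits)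
    then show ?thesis
      by blast
  qed
qed simp

text \<open>The path rises above height \<open>i\<close> by its \<open>(i + 1)\<close>-st
  north-step, so it has a point above \<open>i\<close> in the column of this step and in all later
  ones; the upper bound on \<open>x\<close> says that the column is reached at all.\<close>

lemma weakly_below_Suc_iff:
  assumes "i < norths w"
  shows "weakly_below (x, Suc i) w \<longleftrightarrow> east_counts 0 w ! i \<le> x \<and> x \<le> easts w"
proof -
  obtain p s where w: "w = p @ North # s" and p: "norths p = i" "easts p = east_counts 0 w ! i"
    using split_at_north[OF assms] .
  show ?thesis
  proof
    assume "weakly_below (x, Suc i) w"
    then obtain q t where q: "w = q @ t" "easts q = x" "Suc i \<le> norths q"
      by (auto simp: weakly_below_def points_iff)
    then have "\<exists>r. q = p @ r"
      using w p by (auto simp: append_eq_append_conv2)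
    then show "east_counts 0 w ! i \<le> x \<and> x \<le> easts w"
      using p q by auto
  next
    assume x: "east_counts 0 w ! i \<le> x \<and> x \<le> easts w"
    then have "x - easts p \<le> easts s"
      using w by auto
    then obtain q t where "s = q @ t" "easts q = x - easts p"
      using ex_prefix_easts by blast
    then have "w = (p @ North # q) @ t" "easts (p @ North # q) = x" "Suc i \<le> norths (p @ North # q)"
      using w p x by auto
    then show "weakly_below (x, Suc i) w"
      unfolding weakly_below_def fst_conv snd_conv points_iff by blast
  qed
qed

lemma weakly_below_0_iff: "weakly_below (x, 0) w \<longleftrightarrow> x \<le> easts w"
proof
  assume "x \<le> easts w"
  then show "weakly_below (x, 0) w"
    using ex_prefix_easts[of x w] by (auto simp: weakly_below_def points_iff)
qed (auto simp: weakly_below_def points_iff)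

text \<open>Before its \<open>(y + 1)\<close>-st north-step the path visits every column up to that
  of this step, and afterwards only heights above \<open>y\<close>.\<close>

lemma weakly_above_iff:
  assumes "y < norths w"
  shows "weakly_above (x, y) w \<longleftrightarrow> x \<le> east_counts 0 w ! y"
proof -
  obtain p s where w: "w = p @ North # s" and p: "norths p = y" "easts p = east_counts 0 w ! y"
    using split_at_north[OF assms] .
  show ?thesis
  proof
    assume "weakly_above (x, y) w"
    then obtain q t where q: "w = q @ t" "easts q = x" "norths q \<le> y"
      by (auto simp: weakly_above_def points_iff)
    then have "\<exists>r. p = q @ r"
      using w p by (auto simp: append_eq_append_conv2 Cons_eq_append_conv)
    then show "x \<le> east_counts 0 w ! y"
      using p q by auto
  next
    assume "x \<le> east_counts 0 w ! y"
    then obtain q t where "p = q @ t" "easts q = x"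
      using ex_prefix_easts[of x p] p by auto
    then have "w = q @ (t @ North # s)" "easts q = x" "norths q \<le> y"
      using w p by auto
    then show "weakly_above (x, y) w"
      unfolding weakly_above_def fst_conv snd_conv points_iff by blast
  qed
qed

text \<open>No north-step starts at height \<open>norths w\<close>, so this height is outside
  \<open>weakly_above_iff\<close>; the construction of the steep path tests it after the last
  north-step.\<close>

lemma weakly_above_top_iff: "weakly_above (x, norths w) w \<longleftrightarrow> x \<le> easts w"
proof
  assume "x \<le> easts w"
  then obtain p s where "w = p @ s" "easts p = x"
    using ex_prefix_easts by blast
  then show "weakly_above (x, norths w) w"
    by (auto simp: weakly_above_def points_iff intro!: exI[of _ "norths p"])
qed (auto simp: weakly_above_def points_iff)

text \<open>The \<open>(i + 1)\<close>-st north-step starts from the rightmost point of the path at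
  height \<open>i\<close>, so testing these points suffices; height \<open>n\<close> is covered by
  the number of east-steps.\<close>

lemma Dyck_iff:
  "w \<in> Dyck n \<longleftrightarrow> easts w = n \<and> norths w = n \<and> (\<forall>i<n. east_counts 0 w ! i \<le> i)"
proof
  assume w: "w \<in> Dyck n"
  have "east_counts 0 w ! i \<le> i" if i: "i < n" for i
  proof -
    have "i < norths w"
      using w i by (auto simp: Dyck_def endpoint_def)
    then obtain p s where p: "w = p @ North # s" "norths p = i" "easts p = east_counts 0 w ! i"
      by (rule split_at_north)
    then have "(easts p, norths p) \<in> points w"
      by (auto simp: points_iff)
    then show ?thesis
      using w p by (auto simp: Dyck_def)
  qed
  then show "easts w = n \<and> norths w = n \<and> (\<forall>i<n. east_counts 0 w ! i \<le> i)"
    using w by (auto simp: Dyck_def endpoint_def)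
next
  assume w: "easts w = n \<and> norths w = n \<and> (\<forall>i<n. east_counts 0 w ! i \<le> i)"
  have "x \<le> y" if xy: "(x, y) \<in> points w" for x y
  proof (cases "y < n")
    case True
    have "weakly_above (x, y) w"
      using xy by (auto simp: weakly_above_def)
    then show ?thesis
      using True w weakly_above_iff[of y w x] by force
  next
    case False
    then show ?thesis
      using xy w by (auto simp: points_iff)
  qed
  then show "w \<in> Dyck n"
    using w by (auto simp: Dyck_def endpoint_def)
qed

lemma nested_if_east_counts_le:
  assumes "easts u = easts v" "norths u = norths v"
    and "\<And>i. i < norths u \<Longrightarrow> east_counts 0 v ! i \<le> east_counts 0 u ! i"
  shows "nested u v"
  unfolding nested_def
proof
  fix q assume q: "q \<in> points u"
  obtain x y where xy: "q = (x, y)"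
    by (cases q)
  have below: "weakly_below (x, y) u"
    using q xy by (auto simp: weakly_below_def)
  show "weakly_below q v"
  proof (cases y)
    case 0
    then show ?thesis
      using below assms(1) xy by (simp add: weakly_below_0_iff)
  next
    case (Suc i)
    then have "i < norths u"
      using q xy by (auto simp: points_iff)
    then show ?thesis
      using below assms xy Suc by (force simp: weakly_below_Suc_iff)
  qed
qed

text \<open>In the row of index \<open>i\<close> the boxes extend from the column of the
  \<open>(i + 1)\<close>-st north-step to the diagonal.\<close>

lemma area_vector_eq:
  assumes "w \<in> Dyck n"
  shows "area_vector n w = map (\<lambda>i. i - east_counts 0 w ! i) [0..<n]"
proof -
  have "{x. Suc x \<le> i \<and> weakly_below (x, Suc i) w} = {east_counts 0 w ! i..<i}" if "i < n" for i
    using assms that by (auto simp: weakly_below_Suc_iff Dyck_iff)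
  then show ?thesis
    by (auto simp: area_vector_def)
qed

lemma area_vector_inj:
  assumes "v \<in> Dyck n" "w \<in> Dyck n" "area_vector n v = area_vector n w"
  shows "v = w"
proof -
  have "east_counts 0 v = east_counts 0 w"
  proof (rule nth_equalityI)
    fix i assume "i < length (east_counts 0 v)"
    then have i: "i < n"
      using assms(1) by (auto simp: Dyck_iff)
    have "area_vector n v ! i = area_vector n w ! i"
      using assms(3) by simp
    then have "i - east_counts 0 v ! i = i - east_counts 0 w ! i"
      using i assms(1,2) by (simp add: area_vector_eq)
    \<comment> \<open>The truncated difference \<open>i - c\<close> determines \<open>c\<close>
      because \<open>c \<le> i\<close> on a Dyck path.\<close>
    then show "east_counts 0 v ! i = east_counts 0 w ! i"
      using i assms(1,2) by (auto simp: Dyck_iff) (metis diff_diff_cancel)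
  qed (use assms in \<open>auto simp: Dyck_iff\<close>)
  then show ?thesis
    using assms by (auto simp: Dyck_iff intro: east_counts_inj)
qed

lemma finite_Dyck: "finite (Dyck n)"
proof (rule finite_subset)
  show "Dyck n \<subseteq> {w. set w \<subseteq> {North, East} \<and> length w = n + n}"
  proof
    fix w assume "w \<in> Dyck n"
    moreover have "s \<in> {North, East}" for s
      by (cases s) auto
    ultimately show "w \<in> {w. set w \<subseteq> {North, East} \<and> length w = n + n}"
      by (auto simp: Dyck_iff length_eq_easts_norths)
  qed
  show "finite {w. set w \<subseteq> {North, East} \<and> length w = n + n}"
    by (intro finite_lists_length_eq) auto
qed

section \<open>Valleys determine a Dyck path\<close>

lemma nth_east_counts_valley: "(x, y) \<in> valleys w \<Longrightarrow> y < norths w \<and> east_counts 0 w ! y = x"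
  by (auto simp: valleys_iff east_counts_append nth_append)

text \<open>The last east-step before the \<open>(i + 1)\<close>-st north-step is followed by a
  north-step in the same column, possibly an earlier one; hence only
  \<open>y \<le> i\<close>.\<close>

lemma ex_valley_at_height:
  assumes "i < norths w" "0 < east_counts 0 w ! i"
  shows "\<exists>y\<le>i. (east_counts 0 w ! i, y) \<in> valleys w"
proof -
  obtain p s where w: "w = p @ North # s" and p: "norths p = i" "easts p = east_counts 0 w ! i"
    using split_at_north[OF assms(1)] .
  have "East \<in> set p"
    using p assms(2) by (metis count_notin less_nat_zero_code)
  then obtain q t where qt: "p = q @ East # t" "East \<notin> set t"
    by (metis split_list_last)
  have "\<exists>t'. t @ North # s = North # t'"
    using qt(2) by (cases t; cases "hd t") auto
  then obtain t' where "w = q @ East # North # t'"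
    using w qt by auto
  then have "(Suc (easts q), norths q) \<in> valleys w"
    by (auto simp: valleys_iff)
  moreover have "easts p = Suc (easts q)" "norths q \<le> i"
    using qt p by auto
  ultimately show ?thesis
    using p by auto
qed

lemma mono_east_counts:
  assumes "i \<le> j" "j < norths w"
  shows "east_counts 0 w ! i \<le> east_counts 0 w ! j"
proof -
  have "weakly_below (east_counts 0 w ! j, Suc j) w"
  proof -
    obtain p s where "w = p @ North # s" "easts p = east_counts 0 w ! j"
      using split_at_north[OF assms(2)] .
    then have "east_counts 0 w ! j \<le> easts w"
      by (metis count_list_append le_add1)
    then show ?thesis
      using assms(2) by (simp add: weakly_below_Suc_iff)
  qed
  then have "weakly_below (east_counts 0 w ! j, Suc i) w"
    using assms(1) by (auto simp: weakly_below_def)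
  then show ?thesis
    using assms by (simp add: weakly_below_Suc_iff)
qed

text \<open>This evaluates the \<open>THE\<close> in \<open>Xi_bounce\<close>. A positive east count
  of \<open>v\<close> at \<open>i\<close> is the abscissa of a valley at some
  \<open>y \<le> i\<close>; the same valley of \<open>w\<close> and monotonicity bound the count of
  \<open>w\<close> at \<open>i\<close> from below. By symmetry the counts agree.\<close>

lemma Dyck_eq_if_valleys_eq:
  assumes "v \<in> Dyck n" "w \<in> Dyck n" "valleys v = valleys w"
  shows "v = w"
proof -
  have le: "east_counts 0 v ! i \<le> east_counts 0 w ! i"
    if "v \<in> Dyck n" "w \<in> Dyck n" "valleys v = valleys w" "i < n" for v w i
  proof (cases "east_counts 0 v ! i = 0")
    case False
    then obtain y where y: "y \<le> i" "(east_counts 0 v ! i, y) \<in> valleys w"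
      using ex_valley_at_height[of i v] \<open>v \<in> Dyck n\<close> \<open>i < n\<close> \<open>valleys v = valleys w\<close>
      by (auto simp: Dyck_iff)
    then have "east_counts 0 w ! y = east_counts 0 v ! i"
      using nth_east_counts_valley by blast
    then show ?thesis
      using mono_east_counts[of y i w] y that by (auto simp: Dyck_iff)
  qed simp
  have "east_counts 0 v = east_counts 0 w"
    using assms le[OF assms] le[OF assms(2,1) assms(3)[symmetric]]
    by (intro nth_equalityI) (auto simp: Dyck_iff intro!: antisym)
  then show ?thesis
    using assms by (auto simp: Dyck_iff intro: east_counts_inj)
qed

lemma height_at_before_east:
  assumes "w = p @ East # s"
  shows "height_at w (easts p) = norths p"
proof -
  have "weakly_below (easts p, y) w \<longleftrightarrow> y \<le> norths p" for y
  proof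
    assume "weakly_below (easts p, y) w"
    then obtain q t where q: "w = q @ t" "easts q = easts p" "y \<le> norths q"
      by (auto simp: weakly_below_def points_iff)
    then have "\<exists>r. p = q @ r"
      using assms by (auto simp: append_eq_append_conv2 Cons_eq_append_conv)
    then show "y \<le> norths p"
      using q by auto
  next
    assume "y \<le> norths p"
    then show "weakly_below (easts p, y) w"
      using assms unfolding weakly_below_def points_iff fst_conv snd_conv by blast
  qed
  then have "{y. weakly_below (easts p, y) w} = {..norths p}"
    by auto
  then show ?thesis
    by (simp add: height_at_def Max_eq_iff)
qed

section \<open>Trees and Dyck paths\<close>

text \<open>The right-to-left walk enters the last child first, so splitting off this child is the
  first-return decomposition of the coded Dyck path. The addresses of the nodes below the other
  children do not change.\<close>

lemma ptree_snoc_induct [case_names leaf snoc]: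
  assumes "P (Node [])" "\<And>ts t. P (Node ts) \<Longrightarrow> P t \<Longrightarrow> P (Node (ts @ [t]))"
  shows "P T"
proof (induction T)
  case (Node ts)
  then show ?case
    by (induction ts rule: rev_induct) (use assms in auto)
qed

lemma lr_prefix_leaf [simp]: "lr_prefix (Node []) = [[]]"
  by simp

lemma lr_prefix_snoc [simp]:
  "lr_prefix (Node (ts @ [t])) = lr_prefix (Node ts) @ map ((#) (length ts)) (lr_prefix t)"
  by simp

lemma rl_walk_leaf [simp]: "rl_walk (Node []) = []"
  by simp

lemma rl_walk_snoc [simp]:
  "rl_walk (Node (ts @ [t])) =
    Visit [length ts] # map (map_event ((#) (length ts))) (rl_walk t) @ Return # rl_walk (Node ts)"
  by simp

declare lr_prefix.simps [simp del] rl_walk.simps [simp del]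

section \<open>The right-to-left traversal and the path that it codes\<close>

definition event_nodes :: "node event list \<Rightarrow> node list" where
  "event_nodes w = concat (map (\<lambda>e. case e of Visit u \<Rightarrow> [u] | Return \<Rightarrow> []) w)"

lemma event_nodes_simps [simp]:
  "event_nodes [] = []"
  "event_nodes (Visit u # w) = u # event_nodes w"
  "event_nodes (Return # w) = event_nodes w"
  "event_nodes (w @ w') = event_nodes w @ event_nodes w'"
  by (auto simp: event_nodes_def)

lemma event_nodes_map [simp]: "event_nodes (map (map_event f) w) = map f (event_nodes w)"
proof (induction w)
  case (Cons e w)
  then show ?case
    by (cases e) auto
qed simp

definition rl_nodes :: "ptree \<Rightarrow> node list" where
  "rl_nodes T = event_nodes (rl_walk T)"

lemma rl_nodes_leaf [simp]: "rl_nodes (Node []) = []"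
  by (simp add: rl_nodes_def)

lemma rl_nodes_snoc [simp]:
  "rl_nodes (Node (ts @ [t])) = map ((#) (length ts)) ([] # rl_nodes t) @ rl_nodes (Node ts)"
  by (simp add: rl_nodes_def)

definition tree_path :: "ptree \<Rightarrow> path" where
  "tree_path T = map (\<lambda>e. case e of Visit u \<Rightarrow> North | Return \<Rightarrow> East) (rl_walk T)"

lemma tree_path_leaf [simp]: "tree_path (Node []) = []"
  by (simp add: tree_path_def)

lemma tree_path_snoc [simp]:
  "tree_path (Node (ts @ [t])) = North # tree_path t @ East # tree_path (Node ts)"
proof -
  have "(case map_event f e of Visit u \<Rightarrow> North | Return \<Rightarrow> East) =
      (case e of Visit u \<Rightarrow> North | Return \<Rightarrow> East)" for f :: "node \<Rightarrow> node" and e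
    by (cases e) auto
  then show ?thesis
    by (simp add: tree_path_def comp_def)
qed

lemma hd_lr_prefix: "\<exists>us. lr_prefix T = [] # us \<and> [] \<notin> set us"
  by (induction T rule: ptree_snoc_induct) auto

lemma lr_prefix_Node_index: "i # u \<in> set (lr_prefix (Node ts)) \<Longrightarrow> i < length ts"
  by (induction ts rule: rev_induct) auto

lemma distinct_lr_prefix: "distinct (lr_prefix T)"
proof (induction T rule: ptree_snoc_induct)
  case (snoc ts t)
  then show ?case
    by (auto simp: distinct_map dest: lr_prefix_Node_index)
qed simp

lemma butlast_in_lr_prefix: "u \<in> set (lr_prefix T) \<Longrightarrow> butlast u \<in> set (lr_prefix T)"
proof (induction T arbitrary: u rule: ptree_snoc_induct)
  case (snoc ts t)
  then show ?case
    using hd_lr_prefix[of "Node ts"] by auto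
qed simp

lemma nonroot_nodes_eq: "lr_prefix T = [] # nonroot_nodes T"
  using hd_lr_prefix[of T] by (auto simp: nonroot_nodes_def intro: filter_True[symmetric])

definition level :: "ptree \<Rightarrow> nat \<Rightarrow> node list" where
  "level T k = filter (\<lambda>u. length u = k) (lr_prefix T)"

lemma level_0: "level T 0 = [[]]"
  using hd_lr_prefix[of T] by (auto simp: level_def filter_empty_conv)

lemma level_Suc: "level T (Suc k) = filter (\<lambda>u. length u = Suc k) (nonroot_nodes T)"
  by (simp add: level_def nonroot_nodes_eq)

lemma Nil_notin_rl_nodes: "[] \<notin> set (rl_nodes T)"
  by (induction T rule: ptree_snoc_induct) auto

text \<open>Nodes of equal depth are never nested in each other, so the two traversals meet them in
  opposite orders. The root is absent from \<open>rl_nodes\<close>, hence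
  \<open>0 < k\<close>.\<close>

lemma filter_rl_nodes: "0 < k \<Longrightarrow> filter (\<lambda>u. length u = k) (rl_nodes T) = rev (level T k)"
proof (induction T arbitrary: k rule: ptree_snoc_induct)
  case leaf
  then show ?case by (simp add: level_def)
next
  case (snoc ts t)
  from snoc.prems obtain j where k: "k = Suc j"
    by (cases k) auto
  have "level (Node (ts @ [t])) k = level (Node ts) k @ map ((#) (length ts)) (level t j)"
    by (simp add: level_def filter_map comp_def k)
  moreover have "rev (level t j) = filter (\<lambda>u. length u = j) ([] # rl_nodes t)"
    using snoc.IH(2)[of j] Nil_notin_rl_nodes[of t] by (cases j) (auto simp: level_0 filter_empty_conv[symmetric] intro!: filter_False[symmetric])
  ultimately show ?case
    using snoc.IH(1)[of k] snoc.prems by (auto simp add: filter_map comp_def k rev_map)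
qed

lemma set_rl_nodes: "set (rl_nodes T) = set (nonroot_nodes T)"
proof -
  have "u \<in> set (rl_nodes T) \<longleftrightarrow> u \<in> set (nonroot_nodes T)" if "u \<noteq> []" for u
  proof -
    have "u \<in> set (filter (\<lambda>v. length v = length u) (rl_nodes T)) \<longleftrightarrow> u \<in> set (level T (length u))"
      using that by (subst filter_rl_nodes) auto
    then show ?thesis
      using that by (simp add: level_def nonroot_nodes_eq)
  qed
  moreover have "[] \<notin> set (nonroot_nodes T)"
    by (simp add: nonroot_nodes_def)
  ultimately show ?thesis
    using Nil_notin_rl_nodes[of T] by (intro set_eqI) metis
qed

lemma length_nonroot_nodes: "length (nonroot_nodes T) = length (rl_nodes T)"
proof -
  have "length (lr_prefix T) = Suc (length (rl_nodes T))"
    by (induction T rule: ptree_snoc_induct) auto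
  then show ?thesis
    by (simp add: nonroot_nodes_eq)
qed

lemma norths_tree_path: "norths (tree_path T) = length (rl_nodes T)"
  by (induction T rule: ptree_snoc_induct) auto

lemma easts_tree_path: "easts (tree_path T) = length (rl_nodes T)"
  by (induction T rule: ptree_snoc_induct) auto

text \<open>A tree path stays weakly above its starting diagonal and ends on it, so an east-step
  right after it is the first one to cross that diagonal and marks its end. The free continuations
  \<open>x\<close> and \<open>y\<close> let one induction treat both the last subtree and the
  remaining siblings.\<close>

lemma tree_path_append_East_inj:
  "tree_path T @ East # x = tree_path T' @ East # y \<Longrightarrow> T = T' \<and> x = y"
proof (induction T arbitrary: T' x y rule: ptree_snoc_induct)
  case leaf
  then show ?case
    by (induction T' rule: ptree_snoc_induct) auto
next
  case (snoc ts t)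
  obtain us where T': "T' = Node us"
    by (cases T')
  show ?case
  proof (cases us rule: rev_cases)
    case Nil
    then show ?thesis
      using snoc.prems T' by simp
  next
    case us: (snoc ts' t')
    then have "tree_path t @ East # (tree_path (Node ts) @ East # x) =
        tree_path t' @ East # (tree_path (Node ts') @ East # y)"
      using snoc.prems T' by simp
    then have "t = t'" "tree_path (Node ts) @ East # x = tree_path (Node ts') @ East # y"
      using snoc.IH(2) by blast+
    then show ?thesis
      using snoc.IH(1) T' us by blast
  qed
qed

lemma tree_path_inj: "tree_path T = tree_path T' \<Longrightarrow> T = T'"
  using tree_path_append_East_inj[of T "[]" T' "[]"] by simp

text \<open>
  A path that starts \<open>d\<close> units above the diagonal, stays weakly above it and ends on it is cut at
  its last visits to the heights \<open>d, \<dots>, 1\<close> into \<open>d + 1\<close> Dyck paths, each of which codes a tree.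
\<close>

lemma ex_tree_paths:
  assumes "\<And>p s. w = p @ s \<Longrightarrow> easts p \<le> norths p + d" "easts w = norths w + d"
  shows "\<exists>T Ts. length Ts = d \<and> w = tree_path T @ concat (map (\<lambda>T. East # tree_path T) Ts)"
  using assms
proof (induction w arbitrary: d)
  case Nil
  then show ?case
    by (intro exI[of _ "Node []"] exI[of _ "[]"]) simp
next
  case (Cons s w)
  show ?case
  proof (cases s)
    case North
    have "easts p \<le> norths p + Suc d" if "w = p @ q" for p q
      using Cons.prems(1)[of "s # p" q] that North by simp
    then obtain T Ts where Ts: "length Ts = Suc d"
      "w = tree_path T @ concat (map (\<lambda>T. East # tree_path T) Ts)"
      using Cons.IH[of "Suc d"] Cons.prems(2) North by auto
    then obtain T' Ts' where "Ts = T' # Ts'" "length Ts' = d"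
      by (cases Ts) auto
    moreover obtain ts where "T' = Node ts"
      by (cases T')
    ultimately show ?thesis
      using Ts North by (intro exI[of _ "Node (ts @ [T])"] exI[of _ Ts']) simp
  next
    case East
    have "1 \<le> d"
      using Cons.prems(1)[of "[s]" w] East by simp
    have "easts p \<le> norths p + (d - 1)" if "w = p @ q" for p q
      using Cons.prems(1)[of "s # p" q] that East by simp
    moreover have "easts w = norths w + (d - 1)"
      using Cons.prems(2) East \<open>1 \<le> d\<close> by simp
    ultimately obtain T Ts where "length Ts = d - 1"
      "w = tree_path T @ concat (map (\<lambda>T. East # tree_path T) Ts)"
      using Cons.IH[of "d - 1"] by auto
    then show ?thesis
      using East \<open>1 \<le> d\<close> by (intro exI[of _ "Node []"] exI[of _ "T # Ts"]) simp
  qed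
qed

lemma Dyck_imp_tree_path:
  assumes "w \<in> Dyck n"
  obtains T where "w = tree_path T" "length (nonroot_nodes T) = n"
proof -
  have "easts p \<le> norths p" if "w = p @ s" for p s
  proof -
    have "(easts p, norths p) \<in> points w"
      using that by (auto simp: points_iff)
    then show ?thesis
      using assms by (auto simp: Dyck_def)
  qed
  then obtain T where "w = tree_path T"
    using ex_tree_paths[of w 0] assms by (auto simp: Dyck_iff)
  then show ?thesis
    using that assms by (simp add: Dyck_iff length_nonroot_nodes norths_tree_path)
qed

text \<open>When a node is first visited, its depth is the number of visits, including this one,
  minus the number of returns so far. The parameter \<open>c\<close> accounts for returns made
  before, as needed for the siblings left of the last child.\<close>

lemma east_counts_tree_path:
  "map2 (+) (east_counts c (tree_path T)) (map length (rl_nodes T)) =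
    [Suc c..<Suc (c + length (rl_nodes T))]"
proof (induction T arbitrary: c rule: ptree_snoc_induct)
  case (snoc ts t)
  have suc: "map2 (+) xs (map (\<lambda>u. Suc (length u)) us) = map Suc (map2 (+) xs (map length us))"
    for xs and us :: "node list"
    by (auto simp: zip_map2)
  let ?m = "length (rl_nodes t)" and ?l = "length (rl_nodes (Node ts))"
  have "[Suc c..<Suc (c + length (rl_nodes (Node (ts @ [t]))))] = [Suc c..<Suc (Suc (c + ?m) + ?l)]"
    by (simp add: add.assoc del: upt_Suc)
  also have "\<dots> = [Suc c..<Suc (Suc (c + ?m))] @ [Suc (Suc (c + ?m))..<Suc (Suc (c + ?m) + ?l)]"
    using upt_add_eq_append[of "Suc c" "Suc (Suc (c + ?m))" ?l] by simp
  also have "[Suc c..<Suc (Suc (c + ?m))] = Suc c # map Suc [Suc c..<Suc (c + ?m)]"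
    by (simp add: map_Suc_upt upt_conv_Cons del: upt_Suc)
  finally show ?case
    using snoc.IH(1)[of "Suc (c + ?m)"] snoc.IH(2)[of c]
    by (simp add: east_counts_append easts_tree_path norths_tree_path suc comp_def del: upt_Suc)
qed simp

lemma nth_east_counts_tree_path:
  assumes "i < length (rl_nodes T)"
  shows "east_counts 0 (tree_path T) ! i + length (rl_nodes T ! i) = Suc i"
proof -
  have "map2 (+) (east_counts 0 (tree_path T)) (map length (rl_nodes T)) ! i = Suc i"
    using assms by (simp add: east_counts_tree_path del: upt_Suc)
  then show ?thesis
    using assms by (simp add: norths_tree_path)
qed

lemma tree_path_in_Dyck: "tree_path T \<in> Dyck (length (nonroot_nodes T))"
proof -
  have "east_counts 0 (tree_path T) ! i \<le> i" if "i < length (rl_nodes T)" for i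
  proof -
    have "rl_nodes T ! i \<noteq> []"
      using that Nil_notin_rl_nodes by (metis nth_mem)
    then have "0 < length (rl_nodes T ! i)"
      by simp
    then show ?thesis
      using nth_east_counts_tree_path[OF that] by linarith
  qed
  then show ?thesis
    by (simp add: Dyck_iff length_nonroot_nodes norths_tree_path easts_tree_path)
qed

lemma area_vector_tree_path:
  "area_vector (length (nonroot_nodes T)) (tree_path T) = map (\<lambda>u. length u - 1) (rl_nodes T)"
proof (rule nth_equalityI)
  fix i assume "i < length (area_vector (length (nonroot_nodes T)) (tree_path T))"
  then have i: "i < length (rl_nodes T)"
    by (simp add: area_vector_def length_nonroot_nodes)
  then show "area_vector (length (nonroot_nodes T)) (tree_path T) ! i =
      map (\<lambda>u. length u - 1) (rl_nodes T) ! i"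
    using nth_east_counts_tree_path[OF i] area_vector_eq[OF tree_path_in_Dyck]
    by (simp add: length_nonroot_nodes)
qed (simp add: area_vector_def length_nonroot_nodes)

text \<open>From an internal node the walk descends to the rightmost child. From a leaf it climbs
  and enters the next child to the left of the leaf or of one of its ancestors, so the depth does
  not increase.\<close>

definition rl_successor :: "ptree \<Rightarrow> node \<Rightarrow> node \<Rightarrow> bool" where
  "rl_successor T u v \<longleftrightarrow>
    (if children (subtree T u) \<noteq> [] then v = rightmost_child T u else length v \<le> length u)"

lemma hd_rl_nodes: "rl_nodes T \<noteq> [] \<Longrightarrow> length (hd (rl_nodes T)) = 1"
  by (induction T rule: ptree_snoc_induct) auto

lemma subtree_snoc:
  "subtree (Node (ts @ [t])) (length ts # u) = subtree t u"
  "i < length ts \<Longrightarrow> subtree (Node (ts @ [t])) (i # u) = subtree (Node ts) (i # u)"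
  by (auto simp: nth_append)

lemma rl_successor_snoc:
  "rl_successor (Node (ts @ [t])) (length ts # u) (length ts # v) \<longleftrightarrow> rl_successor t u v"
  "i < length ts \<Longrightarrow> rl_successor (Node (ts @ [t])) (i # u) v \<longleftrightarrow> rl_successor (Node ts) (i # u) v"
  by (auto simp: rl_successor_def rightmost_child_def subtree_snoc simp del: subtree.simps)

text \<open>The root is prepended so that the block of nodes of the last child has the same form as
  the whole list. The second conjunct serves the junction: the block ends in a leaf, and the next
  node has depth 1.\<close>

lemma successively_rl_nodes:
  "successively (rl_successor T) ([] # rl_nodes T) \<and>
    children (subtree T (last ([] # rl_nodes T))) = []"
proof (induction T rule: ptree_snoc_induct)
  case (snoc ts t)
  let ?T = "Node (ts @ [t])" and ?S = "Node ts"
  let ?us = "map ((#) (length ts)) ([] # rl_nodes t)"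
  have index: "\<exists>i u'. u = i # u' \<and> i < length ts" if "u \<in> set (rl_nodes ?S)" for u
  proof -
    have "u \<in> set (lr_prefix ?S)" "u \<noteq> []"
      using that Nil_notin_rl_nodes by (auto simp: set_rl_nodes nonroot_nodes_def)
    then show ?thesis
      using lr_prefix_Node_index by (metis list.exhaust)
  qed
  have us: "successively (rl_successor ?T) ?us"
    using snoc.IH(2) by (simp only: successively_map rl_successor_snoc)
  have "last ?us = length ts # last ([] # rl_nodes t)"
    by (rule last_map) simp
  then have last_us: "children (subtree ?T (last ?us)) = []" "1 \<le> length (last ?us)"
    using snoc.IH(2) by (simp_all only: subtree_snoc) simp
  have rest: "successively (rl_successor ?T) (rl_nodes ?S)"
  proof -
    have "successively (rl_successor ?S) (rl_nodes ?S)"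
      using snoc.IH(1) by (auto simp: successively_Cons)
    then show ?thesis
      by (rule successively_mono) (use index rl_successor_snoc(2) in blast)
  qed
  have first: "rl_successor ?T [] (hd ?us)"
    by (simp add: rl_successor_def rightmost_child_def)
  have junction: "rl_successor ?T (last ?us) (hd (rl_nodes ?S))" if "rl_nodes ?S \<noteq> []"
    using last_us hd_rl_nodes[OF that] unfolding rl_successor_def by presburger
  have "children (subtree ?T (last (rl_nodes ?S))) = []" if nonempty: "rl_nodes ?S \<noteq> []"
  proof -
    obtain i u where "last (rl_nodes ?S) = i # u" "i < length ts"
      using nonempty index[of "last (rl_nodes ?S)"] by auto
    then show ?thesis
      using snoc.IH(1) nonempty by (simp only: subtree_snoc last_ConsR not_False_eq_True)
  qed
  then have "children (subtree ?T (last ([] # ?us @ rl_nodes ?S))) = []"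
    using last_us(1) by (cases "rl_nodes ?S = []")
      (simp_all only: last_append last_ConsR append_Nil2 append_is_Nil_conv
        list.map if_True if_False list.distinct not_False_eq_True simp_thms)
  moreover have "successively (rl_successor ?T) (?us @ rl_nodes ?S)"
    using us rest junction unfolding successively_append_iff by blast
  then have "successively (rl_successor ?T) ([] # ?us @ rl_nodes ?S)"
    using first by (simp add: successively_Cons[of _ "[]"])
  ultimately show ?case
    by (simp only: rl_nodes_snoc)
qed simp

section \<open>Levels and colorings\<close>

lemma rl_nodes_slow: "successively (\<lambda>u v. length v \<le> Suc (length u)) (rl_nodes T)"
proof -
  have "successively (rl_successor T) (rl_nodes T)"
    using successively_rl_nodes[of T] by (auto simp: successively_Cons)
  then show ?thesis
    by (rule successively_mono) (auto simp: rl_successor_def rightmost_child_def split: if_splits)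
qed

section \<open>Levels and the coloring by depth\<close>

lemma take_in_lr_prefix: "u \<in> set (lr_prefix T) \<Longrightarrow> take k u \<in> set (lr_prefix T)"
proof (induction "length u - k" arbitrary: k)
  case (Suc d)
  then have "take (Suc k) u \<in> set (lr_prefix T)"
    by simp
  then have "butlast (take (Suc k) u) \<in> set (lr_prefix T)"
    by (rule butlast_in_lr_prefix)
  then show ?case
    using Suc.hyps by (simp add: butlast_take)
qed simp

definition height :: "ptree \<Rightarrow> nat" where
  "height T = Max (length ` set (lr_prefix T))"

lemma length_le_height: "u \<in> set (lr_prefix T) \<Longrightarrow> length u \<le> height T"
  by (simp add: height_def)

lemma level_nonempty: "k \<le> height T \<Longrightarrow> level T k \<noteq> []"
proof -
  assume k: "k \<le> height T"
  have "height T \<in> length ` set (lr_prefix T)"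
    unfolding height_def using hd_lr_prefix[of T] by (intro Max_in) auto
  then obtain u where "u \<in> set (lr_prefix T)" "length u = height T"
    by auto
  then have "take k u \<in> set (lr_prefix T)" "length (take k u) = k"
    using k take_in_lr_prefix by auto
  then have "take k u \<in> set (level T k)"
    by (simp add: level_def)
  then show ?thesis
    by auto
qed

lemma level_above_height: "height T < k \<Longrightarrow> level T k = []"
  using length_le_height by (fastforce simp: level_def filter_empty_conv)

lemma in_set_level_iff: "0 < k \<Longrightarrow> u \<in> set (level T k) \<longleftrightarrow> u \<in> set (nonroot_nodes T) \<and> length u = k"
  by (auto simp: level_def nonroot_nodes_eq)

lemma distinct_level: "distinct (level T k)"
  by (simp add: level_def distinct_lr_prefix)

lemma in_nonroot_nodes_iff: "u \<in> set (nonroot_nodes T) \<longleftrightarrow> u \<in> set (lr_prefix T) \<and> u \<noteq> []"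
  by (auto simp: nonroot_nodes_def)

definition profile :: "ptree \<Rightarrow> nat list" where
  "profile T = map (\<lambda>k. length (level T (Suc k))) [0..<height T]"

text \<open>Up to the height these are the partial sums of \<open>profile T\<close>. Counting nodes
  keeps the value meaningful beyond the height, where \<open>norths_zeta_prefix\<close> uses it for
  \<open>k = height T\<close>.\<close>

definition depth_count :: "ptree \<Rightarrow> nat \<Rightarrow> nat" where
  "depth_count T k = length (filter (\<lambda>u. length u \<le> k) (nonroot_nodes T))"

lemma depth_count_0: "depth_count T 0 = 0"
  by (auto simp: depth_count_def filter_empty_conv nonroot_nodes_def)

lemma depth_count_Suc: "depth_count T (Suc k) = depth_count T k + length (level T (Suc k))"
proof -
  have "length (filter (\<lambda>u. length u \<le> Suc k) us) =
      length (filter (\<lambda>u. length u \<le> k) us) + length (filter (\<lambda>u. length u = Suc k) us)"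
    for us :: "node list"
    by (induction us) auto
  then show ?thesis
    by (simp add: depth_count_def level_Suc)
qed

lemma depth_count_height: "depth_count T (height T) = length (nonroot_nodes T)"
proof -
  have "filter (\<lambda>u. length u \<le> height T) (nonroot_nodes T) = nonroot_nodes T"
    using length_le_height by (auto simp: in_nonroot_nodes_iff intro!: filter_True)
  then show ?thesis
    by (simp add: depth_count_def)
qed

lemma length_profile [simp]: "length (profile T) = height T"
  by (simp add: profile_def)

lemma nth_profile: "k < height T \<Longrightarrow> profile T ! k = length (level T (Suc k))"
  by (simp add: profile_def)

lemma sum_take_profile: "k \<le> height T \<Longrightarrow> sum_list (take k (profile T)) = depth_count T k"
  by (induction k)
    (auto simp: depth_count_0 depth_count_Suc take_Suc_conv_app_nth nth_profile)

lemma composition_profile: "composition (length (nonroot_nodes T)) (profile T)"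
proof -
  have "sum_list (profile T) = length (nonroot_nodes T)"
    using sum_take_profile[of "height T" T] by (simp add: depth_count_height)
  moreover have "0 < a" if "a \<in> set (profile T)" for a
    using that level_nonempty[of "Suc _" T] by (auto simp: profile_def)
  ultimately show ?thesis
    by (simp add: composition_def)
qed

text \<open>A closed form that mentions no composition, so that it can be compared with the coloring
  for \<open>profile T\<close> and with that for an unknown composition.\<close>

definition depth_coloring :: "ptree \<Rightarrow> nat \<Rightarrow> (node \<rightharpoonup> nat)" where
  "depth_coloring T k u =
    (if u \<in> set (nonroot_nodes T) \<and> length u \<le> k then Some (length u) else None)"

text \<open>A parent is one level above its child, so once exactly the depths up to \<open>k\<close>
  are colored, the uncolored nodes with a colored parent or the root as parent are those of depth
  \<open>k + 1\<close>.\<close>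

lemma active_depth_coloring: "active T (depth_coloring T k) = level T (Suc k)"
  unfolding active_def level_Suc
proof (rule filter_cong)
  fix u assume u: "u \<in> set (nonroot_nodes T)"
  then have "butlast u \<in> set (nonroot_nodes T) \<longleftrightarrow> butlast u \<noteq> []"
    using butlast_in_lr_prefix by (auto simp: in_nonroot_nodes_iff)
  moreover have "0 < length u"
    using u by (simp add: in_nonroot_nodes_iff)
  moreover from this have "butlast u = [] \<longleftrightarrow> length u = 1"
    by (cases u rule: rev_cases) auto
  ultimately show "(u \<notin> dom (depth_coloring T k) \<and>
      (butlast u = [] \<or> butlast u \<in> dom (depth_coloring T k))) = (length u = Suc k)"
    using u by (auto simp: depth_coloring_def dom_def split: if_splits)
qed simp

lemma depth_coloring_Suc:
  "(\<lambda>u. if u \<in> set (level T (Suc k)) then Some (Suc k) else depth_coloring T k u) =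
    depth_coloring T (Suc k)"
  by (rule ext) (auto simp: depth_coloring_def in_set_level_iff)

lemma depth_coloring_0: "depth_coloring T 0 = Map.empty"
  by (rule ext) (auto simp: depth_coloring_def in_nonroot_nodes_iff)

lemma coloring_profile: "k \<le> height T \<Longrightarrow> coloring T (profile T) k = depth_coloring T k"
  by (induction k) (simp_all add: depth_coloring_0 active_depth_coloring nth_profile depth_coloring_Suc
      cong: if_cong)

lemma color_profile: "u \<in> set (nonroot_nodes T) \<Longrightarrow> color T (profile T) u = length u"
  using length_le_height
  by (auto simp: color_def coloring_profile depth_coloring_def in_nonroot_nodes_iff)

lemma profile_in_LAC: "(T, profile T) \<in> LAC (length (nonroot_nodes T))"
  using composition_profile[of T]
  by (auto simp: LAC_def is_alpha_tree_def composition_def coloring_profile active_depth_coloring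
      nth_profile)

section \<open>Colorings for an arbitrary composition\<close>

lemma set_take_activeD:
  assumes "u \<in> set (take m (active T c))"
  shows "u \<in> set (nonroot_nodes T)" "u \<notin> dom c" "butlast u = [] \<or> butlast u \<in> dom c"
  using in_set_takeD[OF assms] by (auto simp: active_def)

text \<open>A parent other than the root is colored in an earlier step than its child, so colors
  grow along each branch and are at least the depth.\<close>

lemma coloring_Some:
  "coloring T \<alpha> k u = Some j \<Longrightarrow> u \<in> set (nonroot_nodes T) \<and> length u \<le> j \<and> j \<le> k"
proof (induction k arbitrary: u j)
  case (Suc k)
  show ?case
  proof (cases "u \<in> set (take (\<alpha> ! k) (active T (coloring T \<alpha> k)))")
    case True
    have "length u \<le> Suc k"
      using set_take_activeD(3)[OF True]
    proof
      assume "butlast u = []"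
      then show ?thesis
        by (cases u) (auto split: if_splits)
    next
      assume "butlast u \<in> dom (coloring T \<alpha> k)"
      then obtain i where "coloring T \<alpha> k (butlast u) = Some i"
        by blast
      then show ?thesis
        using Suc.IH by fastforce
    qed
    then show ?thesis
      using True Suc.prems set_take_activeD(1)[OF True] by simp
  next
    case False
    then show ?thesis
      using Suc.prems Suc.IH[of u j] by simp
  qed
qed simp

lemma dom_coloring_subset: "dom (coloring T \<alpha> k) \<subseteq> set (nonroot_nodes T)"
  by (auto dest: coloring_Some)

lemma coloring_mono:
  "coloring T \<alpha> k u = Some j \<Longrightarrow> k \<le> l \<Longrightarrow> coloring T \<alpha> l u = Some j"
proof (induction l)
  case (Suc l)
  show ?case
  proof (cases "k = Suc l")
    case False
    then have "coloring T \<alpha> l u = Some j"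
      using Suc by simp
    then show ?thesis
      using set_take_activeD(2)[of u _ T "coloring T \<alpha> l"] by auto
  qed (use Suc in simp)
qed simp

lemma coloring_earlier:
  "coloring T \<alpha> l u = Some j \<Longrightarrow> j \<le> k \<Longrightarrow> k \<le> l \<Longrightarrow> coloring T \<alpha> k u = Some j"
proof (induction l)
  case (Suc l)
  then show ?case
    by (cases "k = Suc l") (auto split: if_splits)
qed simp

lemma distinct_active: "distinct (active T c)"
  using distinct_lr_prefix[of T] by (simp add: active_def nonroot_nodes_def)

lemma card_dom_coloring:
  assumes "is_alpha_tree \<alpha> T"
  shows "k \<le> length \<alpha> \<Longrightarrow> card (dom (coloring T \<alpha> k)) = sum_list (take k \<alpha>)"
proof (induction k)
  case (Suc k)
  let ?c = "coloring T \<alpha> k"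
  let ?us = "take (\<alpha> ! k) (active T ?c)"
  have "\<alpha> ! k \<le> length (active T ?c)"
    using assms Suc.prems by (simp add: is_alpha_tree_def)
  then have "card (set ?us) = \<alpha> ! k"
    by (simp add: distinct_card distinct_active)
  moreover have "dom (coloring T \<alpha> (Suc k)) = set ?us \<union> dom ?c"
    by (auto simp: dom_def)
  moreover have "set ?us \<inter> dom ?c = {}"
    using set_take_activeD(2)[of _ "\<alpha> ! k" T ?c] by blast
  moreover have "finite (dom ?c)"
    using dom_coloring_subset by (rule finite_subset) simp
  ultimately show ?case
    using Suc by (simp add: card_Un_disjoint take_Suc_conv_app_nth)
qed simp

text \<open>No step fails, so the number of colored nodes is the sum of the parts of the
  composition, which is the number of all non-root nodes.\<close>

lemma all_colored:
  assumes "is_alpha_tree \<alpha> T"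
  shows "dom (coloring T \<alpha> (length \<alpha>)) = set (nonroot_nodes T)"
proof (rule card_subset_eq)
  show "dom (coloring T \<alpha> (length \<alpha>)) \<subseteq> set (nonroot_nodes T)"
    by (rule dom_coloring_subset)
  have "card (set (nonroot_nodes T)) = length (nonroot_nodes T)"
    using distinct_lr_prefix[of T] by (intro distinct_card) (simp add: nonroot_nodes_def)
  then show "card (dom (coloring T \<alpha> (length \<alpha>))) = card (set (nonroot_nodes T))"
    using card_dom_coloring[OF assms, of "length \<alpha>"] assms by (simp add: is_alpha_tree_def)
qed simp

section \<open>The second path of the steep pair as a word over a list of nodes\<close>

fun expansion :: "(node \<Rightarrow> nat) \<Rightarrow> nat set \<Rightarrow> node list \<Rightarrow> path" where
  "expansion c A [] = []"
| "expansion c A (u # us) =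
    (if c u \<in> A then [East, North] else [North]) @ expansion c (insert (c u) A) us"

lemma expand_mark_walk: "expand_marks (mark_walk c A w) = expansion c A (event_nodes w)"
  by (induction c A w rule: mark_walk.induct) (auto simp: expand_marks_def)

lemma forget_mark_walk:
  "forget_marks (mark_walk c A w) = map (\<lambda>e. case e of Visit u \<Rightarrow> North | Return \<Rightarrow> East) w"
  by (induction c A w rule: mark_walk.induct) (auto simp: forget_marks_def)

lemma Xi_steep_eq:
  "Xi_steep (T, \<alpha>) =
    (let v = expansion (color T \<alpha>) {} (rl_nodes T)
     in (tree_path T, v @ replicate (length (nonroot_nodes T) - easts v) East))"
  by (simp add: Xi_steep_def Let_def expand_mark_walk forget_mark_walk rl_nodes_def tree_path_def)

lemma expansion_cong: "(\<And>u. u \<in> set us \<Longrightarrow> c u = c' u) \<Longrightarrow> expansion c A us = expansion c' A us"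
  by (induction us arbitrary: A) auto

text \<open>Each node contributes a block \<open>N\<close> or \<open>EN\<close>. Every block ends at
  its north-step, so the word can be decoded uniquely, and the final east-steps do not
  interfere.\<close>

lemma expansion_eq_imp_marks_eq:
  assumes "expansion c A us @ replicate a East = expansion c' B us @ replicate b East"
    and "us = xs @ u # ys"
  shows "c u \<in> A \<union> c ` set xs \<longleftrightarrow> c' u \<in> B \<union> c' ` set xs"
  using assms
proof (induction xs arbitrary: A B us)
  case Nil
  then show ?case
    by (auto split: if_splits)
next
  case (Cons x xs)
  have "expansion c (insert (c x) A) (xs @ u # ys) @ replicate a East =
      expansion c' (insert (c' x) B) (xs @ u # ys) @ replicate b East"
    using Cons.prems by (auto split: if_splits)
  from Cons.IH[OF this] show ?case
    by auto
qed

lemma norths_expansion: "norths (expansion c A us) = length us"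
  by (induction us arbitrary: A) auto

lemma easts_expansion_le: "easts (expansion c A us) \<le> length us"
  by (induction us arbitrary: A) (auto intro: le_SucI)

text \<open>The leading \<open>North\<close> stands for the end of the previous block, before which
  an \<open>East\<close> may follow without producing two consecutive east-steps.\<close>

lemma successively_expansion:
  "successively (\<lambda>s t. \<not> (s = East \<and> t = East)) (North # expansion c A us)"
  by (induction us arbitrary: A) auto

lemma steep_expansion: "steep (expansion c A us @ replicate m East)"
proof -
  let ?v = "expansion c A us"
  let ?w = "?v @ replicate m East"
  have False if ij: "Suc i < j" "j < length ?w" "?w ! i = East" "?w ! Suc i = East" "?w ! j = North"
    for i j
  proof -
    have "j < length ?v"
      using ij(2,5) by (auto simp: nth_append split: if_splits)
    then have i: "Suc i < length ?v"
      using ij(1) by simp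
    then have "?v ! i = East" "?v ! Suc i = East"
      using ij(3,4) by (auto simp: nth_append)
    then have "?v = take i ?v @ East # East # drop (Suc (Suc i)) ?v"
      using i by (metis Cons_nth_drop_Suc Suc_lessD append_take_drop_id)
    then have "successively (\<lambda>s t. \<not> (s = East \<and> t = East)) (North # take i ?v @ East # East # drop (Suc (Suc i)) ?v)"
      using successively_expansion[of c A us] by metis
    then show False
      by (simp add: successively_Cons successively_append_iff)
  qed
  then show ?thesis
    by (auto simp: steep_def)
qed

text \<open>
  The node that is visited first among those of colour \<open>k + 1\<close> is the first one of its depth in
  right-to-left order, hence the last active node at step \<open>k + 1\<close>; so no active node is skipped.
\<close>

lemma LAC_eq_profile:
  assumes comp: "composition n \<alpha>" and alpha: "is_alpha_tree \<alpha> T"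
    and eq: "expansion (color T \<alpha>) {} (rl_nodes T) @ replicate a East =
      expansion length {} (rl_nodes T) @ replicate b East"
  shows "\<alpha> = profile T"
proof -
  let ?c = "coloring T \<alpha>"
  \<comment> \<open>If the first \<open>k\<close> steps have colored exactly the depths up to
    \<open>k\<close>, then the next step must color the whole next level.\<close>
  have step: "\<alpha> ! k = length (level T (Suc k))"
    if k: "k < length \<alpha>" and ck: "?c k = depth_coloring T k" for k
  proof -
    let ?A = "level T (Suc k)"
    have active: "active T (?c k) = ?A"
      by (simp add: ck active_depth_coloring)
    have "0 < \<alpha> ! k"
      using comp k by (simp add: composition_def)
    have le: "\<alpha> ! k \<le> length ?A"
      using alpha k active by (auto simp: is_alpha_tree_def)
    have final: "color T \<alpha> u = j" if "?c l u = Some j" "l \<le> length \<alpha>" for u l j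
      using coloring_mono[OF that] by (simp add: color_def)
    have "?A \<noteq> []"
      using \<open>0 < \<alpha> ! k\<close> le by auto
    have "hd ?A \<in> set (take (\<alpha> ! k) ?A)"
      using \<open>0 < \<alpha> ! k\<close> \<open>?A \<noteq> []\<close> by (cases ?A; cases "\<alpha> ! k") auto
    then have "?c (Suc k) (hd ?A) = Some (Suc k)"
      by (simp add: active)
    from final[OF this] have "color T \<alpha> (hd ?A) = Suc k"
      using k by simp
    moreover have "hd ?A \<in> set (rl_nodes T)"
      using hd_in_set[OF \<open>?A \<noteq> []\<close>] by (simp add: in_set_level_iff set_rl_nodes)
    ultimately have "\<exists>u\<in>set (rl_nodes T). color T \<alpha> u = Suc k"
      by blast
    then obtain xs u ys where split: "rl_nodes T = xs @ u # ys" and u: "color T \<alpha> u = Suc k"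
      and xs: "\<forall>v\<in>set xs. color T \<alpha> v \<noteq> Suc k"
      by (rule split_list_first_propE)
    \<comment> \<open>The node \<open>u\<close> brings a new color, so its block is a single
      north-step; by \<open>eq\<close> it brings a new depth as well.\<close>
    have "color T \<alpha> u \<notin> {} \<union> color T \<alpha> ` set xs"
      using u xs by auto
    then have new: "length u \<notin> length ` set xs"
      using expansion_eq_imp_marks_eq[OF eq split] by simp
    have "u \<in> set (nonroot_nodes T)"
      using split by (simp add: set_rl_nodes[symmetric])
    then have "u \<in> dom (?c (length \<alpha>))"
      by (simp only: all_colored[OF alpha])
    then have cu: "?c (length \<alpha>) u = Some (Suc k)"
      using u by (auto simp: color_def)
    \<comment> \<open>Nodes of depth at most \<open>k\<close> already have their depth as color, and
      no color is below the depth. This leaves only depth \<open>Suc k\<close> for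
      \<open>u\<close>.\<close>
    have "\<not> length u \<le> k"
      using final[of k u "length u"] k u \<open>u \<in> set (nonroot_nodes T)\<close>
      by (auto simp: ck depth_coloring_def)
    then have len: "length u = Suc k"
      using coloring_Some[OF cu] by simp
    have "filter (\<lambda>v. length v = Suc k) xs = []"
      using new len by (metis (mono_tags, lifting) filter_False imageI)
    then have "rev ?A = u # filter (\<lambda>v. length v = Suc k) ys"
      using filter_rl_nodes[of "Suc k" T] by (simp add: split len)
    then have last: "u = last ?A"
      by (metis hd_rev list.sel(1))
    have "?c (Suc k) u = Some (Suc k)"
      using k by (intro coloring_earlier[OF cu]) auto
    moreover have "?c k u \<noteq> Some (Suc k)"
      using coloring_Some[of T \<alpha> k u "Suc k"] by auto
    ultimately have "u \<in> set (take (\<alpha> ! k) ?A)"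
      by (auto simp: active split: if_splits)
    then obtain i where i: "i < \<alpha> ! k" "i < length ?A" "?A ! i = u"
      by (auto simp: in_set_conv_nth)
    then have "i = length ?A - 1"
      using last distinct_level[of T "Suc k"] by (simp add: last_conv_nth nth_eq_iff_index_eq \<open>?A \<noteq> []\<close>)
    then show ?thesis
      using i le by simp
  qed
  have greedy: "?c k = depth_coloring T k" if "k \<le> length \<alpha>" for k
    using that
  proof (induction k)
    case (Suc k)
    then have ck: "?c k = depth_coloring T k"
      by simp
    then show ?case
      using step[of k] Suc.prems by (simp add: active_depth_coloring depth_coloring_Suc cong: if_cong)
  qed (simp add: depth_coloring_0)
  \<comment> \<open>A further part would be the size of a level beyond the height, hence 0, but
    parts are positive.\<close>
  have "length \<alpha> \<le> height T"
  proof (rule ccontr)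
    assume "\<not> length \<alpha> \<le> height T"
    then have "\<alpha> ! height T = 0"
      using step[of "height T"] greedy level_above_height[of T "Suc (height T)"] by simp
    then show False
      using \<open>\<not> length \<alpha> \<le> height T\<close> comp by (metis composition_def leI less_irrefl nth_mem)
  qed
  \<comment> \<open>A deepest node gets colored in the end, and coloring by depth reaches it only in
    the step given by its depth.\<close>
  moreover have "height T \<le> length \<alpha>"
  proof (cases "height T")
    case (Suc h)
    then obtain u where "u \<in> set (level T (Suc h))"
      using level_nonempty[of "Suc h" T] by (metis le_refl list.set_sel(1))
    then have "u \<in> set (nonroot_nodes T)" "length u = height T"
      by (auto simp: in_set_level_iff Suc)
    moreover from this(1) have "u \<in> dom (depth_coloring T (length \<alpha>))"
      using greedy[of "length \<alpha>"] by (simp only: all_colored[OF alpha, symmetric] order_refl)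
    ultimately show ?thesis
      by (auto simp: depth_coloring_def split: if_splits)
  qed simp
  ultimately show ?thesis
    using step greedy by (intro nth_equalityI) (auto simp: nth_profile)
qed

section \<open>The steep path\<close>

text \<open>The state right after a north-step, with the test for an east-step still pending.
  Cutting the recursion here makes one unfolding produce exactly the block of the next node.\<close>

definition after_north :: "nat \<Rightarrow> path \<Rightarrow> nat \<Rightarrow> nat \<Rightarrow> path" where
  "after_north n \<mu> x y =
    (if weakly_above (Suc x, y) \<mu> then East # steep_from n \<mu> (Suc x) y else steep_from n \<mu> x y)"

lemma steep_from_after_north:
  "steep_from n \<mu> x y = (if n \<le> y then replicate (n - x) East else North # after_north n \<mu> x (Suc y))"
  by (subst steep_from.simps) (simp add: after_north_def)

text \<open>
  The steep path of \<open>tree_path T\<close> gets an east-step before a north-step exactly if the depth of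
  the corresponding node does not exceed the maximal depth \<open>M\<close> of the nodes visited before.
\<close>

lemma after_north_tree_path:
  fixes T
  defines "n \<equiv> length (nonroot_nodes T)" and "\<mu> \<equiv> tree_path T"
  assumes "rl_nodes T = us @ vs" "us \<noteq> []" "length ` set us = {1..M}" "x + M = length us"
  shows "after_north n \<mu> x (length us) =
      expansion length {1..M} vs @ replicate (n - x - easts (expansion length {1..M} vs)) East \<and>
    (\<forall>i<length vs. east_counts x (expansion length {1..M} vs) ! i \<le> east_counts 0 \<mu> ! (length us + i))"
  using assms(3-)
proof (induction vs arbitrary: us x M)
  case Nil
  then have n: "length us = norths \<mu>" "n = norths \<mu>" "easts \<mu> = norths \<mu>"
    by (simp_all add: n_def \<mu>_def norths_tree_path easts_tree_path length_nonroot_nodes)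
  \<comment> \<open>At height \<open>n\<close> an east-step that passes the test is just the first
    of the final east-steps, so both outcomes of the test give the same word.\<close>
  have "after_north n \<mu> x (length us) = replicate (n - x) East"
  proof (cases "Suc x \<le> norths \<mu>")
    case True
    then have "norths \<mu> - x = Suc (norths \<mu> - Suc x)"
      by simp
    then show ?thesis
      using True by (simp add: after_north_def n weakly_above_top_iff steep_from_after_north)
  next
    case False
    then show ?thesis
      by (simp add: after_north_def n weakly_above_top_iff steep_from_after_north)
  qed
  then show ?case
    by simp
next
  case (Cons v vs)
  let ?y = "length us"
  have n: "?y < norths \<mu>" "n = norths \<mu>" "n = ?y + Suc (length vs)"
    using Cons.prems by (simp_all add: n_def \<mu>_def norths_tree_path length_nonroot_nodes)
  then have lt: "\<not> n \<le> ?y"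
    by simp
  have "east_counts 0 \<mu> ! ?y + length (rl_nodes T ! ?y) = Suc ?y"
    unfolding \<mu>_def by (rule nth_east_counts_tree_path) (simp add: Cons.prems)
  then have ec: "east_counts 0 \<mu> ! ?y + length v = Suc ?y"
    by (simp add: Cons.prems)
  have pos: "1 \<le> length v"
    using Nil_notin_rl_nodes[of T] Cons.prems(1) by (cases v) auto
  have "length v \<le> Suc (length (last us))"
    using rl_nodes_slow[of T] Cons.prems(1,2) by (auto simp: successively_append_iff)
  moreover have "length (last us) \<in> {1..M}"
    using Cons.prems(2,3) by (metis imageI last_in_set)
  ultimately have slow: "length v \<le> Suc M"
    by simp
  \<comment> \<open>Each visited node has contributed either an east-step or a new maximal depth,
    whence the invariant \<open>x + M = ?y\<close>. By \<open>ec\<close> the condition reads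
    \<open>Suc x \<le> Suc ?y - length v\<close>, that is, \<open>length v \<le> M\<close>.\<close>
  have above: "weakly_above (Suc x, ?y) \<mu> \<longleftrightarrow> length v \<le> M"
    using ec Cons.prems(4) weakly_above_iff[OF n(1), of "Suc x"] by auto
  have nodes: "rl_nodes T = (us @ [v]) @ vs"
    using Cons.prems by simp
  show ?case
  proof (cases "length v \<le> M")
    case True
    then have M: "insert (length v) {1..M} = {1..M}"
      using pos by auto
    then have "length ` set (us @ [v]) = {1..M}"
      using Cons.prems(3) by simp
    then have IH: "after_north n \<mu> (Suc x) (Suc ?y) =
        expansion length {1..M} vs @ replicate (n - Suc x - easts (expansion length {1..M} vs)) East"
      "\<forall>i<length vs. east_counts (Suc x) (expansion length {1..M} vs) ! i \<le> east_counts 0 \<mu> ! Suc (?y + i)"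
      using Cons.IH[of "us @ [v]" M "Suc x"] nodes Cons.prems(4) by auto
    have v: "length v \<in> {1..M}"
      using True pos by simp
    have first: "after_north n \<mu> x ?y = East # North # after_north n \<mu> (Suc x) (Suc ?y)"
      using above True lt by (simp add: after_north_def[of n \<mu> x ?y] steep_from_after_north)
    have "Suc x \<le> east_counts 0 \<mu> ! ?y"
      using above True weakly_above_iff[OF n(1)] by simp
    moreover have "expansion length {1..M} (v # vs) = East # North # expansion length {1..M} vs"
      using v by (simp only: expansion.simps M if_True append.simps)
    ultimately show ?thesis
      using IH by (simp add: first nth_Cons' del: expansion.simps) (auto simp: gr0_conv_Suc)
  next
    case False
    then have v: "length v = Suc M"
      using slow by simp
    then have M: "insert (length v) {1..M} = {1..Suc M}"
      by auto
    then have "length ` set (us @ [v]) = {1..Suc M}"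
      using Cons.prems(3) by simp
    then have IH: "after_north n \<mu> x (Suc ?y) =
        expansion length {1..Suc M} vs @ replicate (n - x - easts (expansion length {1..Suc M} vs)) East"
      "\<forall>i<length vs. east_counts x (expansion length {1..Suc M} vs) ! i \<le> east_counts 0 \<mu> ! Suc (?y + i)"
      using Cons.IH[of "us @ [v]" "Suc M" x] nodes Cons.prems(4) by auto
    have notin: "length v \<notin> {1..M}"
      by (simp add: v)
    have first: "after_north n \<mu> x ?y = North # after_north n \<mu> x (Suc ?y)"
      using above False lt by (simp add: after_north_def[of n \<mu> x ?y] steep_from_after_north)
    have "x \<le> east_counts 0 \<mu> ! ?y"
      using ec v Cons.prems(4) by simp
    moreover have "expansion length {1..M} (v # vs) = North # expansion length {1..Suc M} vs"
      using notin by (simp only: expansion.simps M if_False append.simps)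
    ultimately show ?thesis
      using IH by (simp add: first nth_Cons' del: expansion.simps) (auto simp: gr0_conv_Suc)
  qed
qed

lemma steep_path_tree_path:
  fixes T
  defines "n \<equiv> length (nonroot_nodes T)" and "\<mu> \<equiv> tree_path T" and "v \<equiv> expansion length {} (rl_nodes T)"
  shows "steep_path n \<mu> = v @ replicate (n - easts v) East"
    and "\<forall>i<n. east_counts 0 v ! i \<le> east_counts 0 \<mu> ! i"
proof -
  have "steep_path n \<mu> = v @ replicate (n - easts v) East \<and>
      (\<forall>i<n. east_counts 0 v ! i \<le> east_counts 0 \<mu> ! i)"
  proof (cases "rl_nodes T")
    case Nil
    then show ?thesis
      by (simp add: n_def v_def length_nonroot_nodes steep_path_def steep_from.simps)
  next
    case (Cons u us)
    have u: "length u = 1"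
      using hd_rl_nodes[of T] Cons by simp
    have n: "n = Suc (length us)"
      by (simp add: n_def length_nonroot_nodes Cons)
    have v: "v = North # expansion length {1..1} us"
      by (simp add: v_def Cons u)
    \<comment> \<open>The first north-step is forced and belongs to a node of depth 1, so the
      invariant starts with \<open>x = 0\<close>, \<open>M = 1\<close> after one node.\<close>
    have "after_north n \<mu> 0 1 = expansion length {1..1} us @
        replicate (n - easts (expansion length {1..1} us)) East"
      "\<forall>i<length us. east_counts 0 (expansion length {1..1} us) ! i \<le> east_counts 0 \<mu> ! Suc i"
      using after_north_tree_path[of T "[u]" us 1 0] Cons u by (simp_all add: n_def \<mu>_def)
    then show ?thesis
      by (simp add: v n steep_path_def steep_from_after_north[of _ _ 0 0] nth_Cons')
        (auto simp: gr0_conv_Suc less_Suc_eq_0_disj)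
  qed
  then show "steep_path n \<mu> = v @ replicate (n - easts v) East"
    "\<forall>i<n. east_counts 0 v ! i \<le> east_counts 0 \<mu> ! i"
    by blast+
qed

lemma Xi_steep_profile:
  "Xi_steep (T, profile T) = (tree_path T, steep_path (length (nonroot_nodes T)) (tree_path T))"
proof -
  have "expansion (color T (profile T)) {} (rl_nodes T) = expansion length {} (rl_nodes T)"
    by (rule expansion_cong) (simp add: color_profile set_rl_nodes)
  then show ?thesis
    by (simp add: Xi_steep_eq Let_def steep_path_tree_path(1))
qed

text \<open>Computes the fibre of \<open>Xi_steep\<close> over such a pair: the first component
  determines the tree, the second one the composition. This is what evaluates
  \<open>the_inv_into\<close> in \<open>Gamma\<close>.\<close>

lemma Xi_steep_eq_steep_path_imp:
  assumes "(T', \<alpha>) \<in> LAC n" "Xi_steep (T', \<alpha>) = (tree_path T, steep_path n (tree_path T))"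
    and "n = length (nonroot_nodes T)"
  shows "T' = T \<and> \<alpha> = profile T"
proof
  show "T' = T"
    using assms(2) by (auto simp: Xi_steep_eq Let_def intro: tree_path_inj)
  then show "\<alpha> = profile T"
    using assms by (intro LAC_eq_profile) (auto simp: Xi_steep_eq Let_def LAC_def steep_path_tree_path(1))
qed

lemma steep_pair_in_SP:
  assumes "\<mu> \<in> Dyck n"
  shows "(\<mu>, steep_path n \<mu>) \<in> SP n"
proof -
  obtain T where T: "\<mu> = tree_path T" "length (nonroot_nodes T) = n"
    using Dyck_imp_tree_path[OF assms] .
  define v where "v = expansion length {} (rl_nodes T)"
  have steep: "steep_path n \<mu> = v @ replicate (n - easts v) East"
    and le: "\<forall>i<n. east_counts 0 v ! i \<le> east_counts 0 \<mu> ! i"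
    using steep_path_tree_path[of T] by (simp_all add: T v_def)
  have v: "norths v = n" "easts v \<le> n"
    using T easts_expansion_le[of length "{}" "rl_nodes T"]
    by (simp_all add: v_def norths_expansion length_nonroot_nodes)
  have counts: "norths (steep_path n \<mu>) = n" "easts (steep_path n \<mu>) = n"
    using v by (simp_all add: steep)
  have "east_counts 0 (steep_path n \<mu>) ! i = east_counts 0 v ! i" if "i < n" for i
    using that v by (simp add: steep east_counts_append nth_append)
  then have le': "\<forall>i<n. east_counts 0 (steep_path n \<mu>) ! i \<le> east_counts 0 \<mu> ! i"
    using le by simp
  then have "steep_path n \<mu> \<in> Dyck n"
    using assms counts by (auto simp: Dyck_iff intro: order_trans)
  moreover have "nested \<mu> (steep_path n \<mu>)"
    using le' assms counts by (intro nested_if_east_counts_le) (auto simp: Dyck_iff)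
  moreover have "steep (steep_path n \<mu>)"
    by (simp add: steep v_def steep_expansion)
  ultimately show ?thesis
    using assms by (simp add: SP_def)
qed

section \<open>The path of consecutive levels\<close>

text \<open>A discrete intermediate value principle: with increments of at most one,
  \<open>Suc k\<close> can only be entered from below through \<open>k\<close>.\<close>

lemma slow_list_passes:
  "successively (\<lambda>a b. b \<le> Suc a) (x # xs @ [Suc k]) \<Longrightarrow> x \<le> k \<Longrightarrow> k \<in> set (x # xs)"
proof (induction xs arbitrary: x)
  case (Cons y xs)
  then show ?case
    by (cases "x = k") auto
qed auto

lemma slow_list_first:
  assumes slow: "successively (\<lambda>a b. b \<le> Suc a) (x # xs)" and "x \<le> k"
    and eq: "filter (\<lambda>a. a = k \<or> a = Suc k) (x # xs) = y # ys"
  shows "y = k"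
proof (rule ccontr)
  assume "y \<noteq> k"
  obtain as bs where split: "x # xs = as @ y # bs" "\<forall>a\<in>set as. a \<noteq> k \<and> a \<noteq> Suc k" "y = k \<or> y = Suc k"
    using filter_eq_ConsD[OF eq] by blast
  then have y: "y = Suc k"
    using \<open>y \<noteq> k\<close> by simp
  then obtain as' where as: "as = x # as'"
    using split(1) \<open>x \<le> k\<close> by (cases as) auto
  have "successively (\<lambda>a b. b \<le> Suc a) ((x # as' @ [Suc k]) @ bs)"
    using slow split(1) as y by simp
  then have "successively (\<lambda>a b. b \<le> Suc a) (x # as' @ [Suc k])"
    by (simp only: successively_append_iff)
  then have "k \<in> set as"
    using slow_list_passes[of x as' k] \<open>x \<le> k\<close> as by simp
  then show False
    using split(2) by blast
qed

text \<open>This gives the uniqueness of the area vector in \<open>zeta_inv\<close>. If the first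
  entries were \<open>x < y\<close>, the restriction to \<open>{y - 1, y}\<close> would start with
  \<open>y\<close> on one side, but with \<open>y - 1\<close> on the other, by
  \<open>slow_list_first\<close>. Equal first entries cancel.\<close>

lemma slow_lists_eq:
  assumes "successively (\<lambda>a b. b \<le> Suc a) xs" "successively (\<lambda>a b. b \<le> Suc a) ys"
    and "\<And>k. filter (\<lambda>a. a = k \<or> a = Suc k) xs = filter (\<lambda>a. a = k \<or> a = Suc k) ys"
  shows "xs = ys"
  using assms
proof (induction xs arbitrary: ys)
  case Nil
  show ?case
  proof (cases ys)
    case (Cons y ys')
    then show ?thesis
      using Nil.prems(3)[of y] by simp
  qed simp
next
  case (Cons x xs)
  show ?case
  proof (cases ys)
    case Nil
    then show ?thesis
      using Cons.prems(3)[of x] by simp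
  next
    case ys: (Cons y ys')
    have less: False
      if "successively (\<lambda>a b. b \<le> Suc a) (x # xs)" "x < y"
        "\<And>k. filter (\<lambda>a. a = k \<or> a = Suc k) (x # xs) = filter (\<lambda>a. a = k \<or> a = Suc k) (y # ys)"
      for x y xs ys
    proof -
      obtain k where k: "y = Suc k" "x \<le> k"
        using \<open>x < y\<close> by (cases y) auto
      then show False
        using slow_list_first[OF that(1) k(2), of y] that(3)[of k] by simp
    qed
    have "\<not> x < y"
      using less[OF Cons.prems(1)] Cons.prems(3) ys by blast
    moreover have "\<not> y < x"
      using less[of y ys' x xs] Cons.prems(2) Cons.prems(3)[symmetric] ys by blast
    ultimately have "x = y"
      by simp
    have "filter (\<lambda>a. a = k \<or> a = Suc k) xs = filter (\<lambda>a. a = k \<or> a = Suc k) ys'" for k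
      using Cons.prems(3)[of k] by (simp add: ys \<open>x = y\<close> split: if_splits)
    moreover have "successively (\<lambda>a b. b \<le> Suc a) xs" "successively (\<lambda>a b. b \<le> Suc a) ys'"
      using Cons.prems(1,2) by (auto simp: ys successively_Cons)
    ultimately have "xs = ys'"
      by (intro Cons.IH)
    then show ?thesis
      by (simp add: ys \<open>x = y\<close>)
  qed
qed

section \<open>Level words and the path built from them\<close>

definition two_levels :: "ptree \<Rightarrow> nat \<Rightarrow> node list" where
  "two_levels T k = filter (\<lambda>u. length u = k \<or> length u = Suc k) (rl_nodes T)"

definition level_word :: "ptree \<Rightarrow> nat \<Rightarrow> path" where
  "level_word T k = map (\<lambda>u. if length u = k then East else North) (two_levels T k)"

text \<open>The initial north-steps act as a word for the depths 0 and 1 in which the root is not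
  read. With the words up to \<open>k\<close> appended, the path arrives at
  \<open>(depth_count T k, depth_count T (Suc k))\<close>.\<close>

primrec zeta_prefix :: "ptree \<Rightarrow> nat \<Rightarrow> path" where
  "zeta_prefix T 0 = replicate (length (level T 1)) North"
| "zeta_prefix T (Suc k) = zeta_prefix T k @ level_word T (Suc k)"

definition zeta_path :: "ptree \<Rightarrow> path" where
  "zeta_path T = zeta_prefix T (height T)"

lemma filter_two_levels:
  assumes "0 < k"
  shows "filter (\<lambda>u. length u = k) (two_levels T k) = rev (level T k)"
    and "filter (\<lambda>u. length u = Suc k) (two_levels T k) = rev (level T (Suc k))"
  using assms filter_rl_nodes[of k T] filter_rl_nodes[of "Suc k" T]
  by (simp_all add: two_levels_def filter_filter conj_disj_distribL conj_disj_distribR cong: conj_cong)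

lemma easts_map_level: "easts (map (\<lambda>u. if length u = k then East else North) us) =
    length (filter (\<lambda>u. length u = k) us)"
  by (induction us) auto

lemma norths_map_level:
  assumes "\<forall>u\<in>set us. length u = k \<or> length u = Suc k"
  shows "norths (map (\<lambda>u. if length u = k then East else North) us) =
    length (filter (\<lambda>u. length u = Suc k) us)"
  using assms by (induction us) auto

lemma in_two_levels: "u \<in> set (two_levels T k) \<Longrightarrow> length u = k \<or> length u = Suc k"
  by (simp add: two_levels_def)

lemma easts_level_word: "0 < k \<Longrightarrow> easts (level_word T k) = length (level T k)"
  by (simp add: level_word_def easts_map_level filter_two_levels)

lemma norths_level_word: "0 < k \<Longrightarrow> norths (level_word T k) = length (level T (Suc k))"
  by (simp add: level_word_def norths_map_level in_two_levels filter_two_levels)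

lemma easts_zeta_prefix: "easts (zeta_prefix T k) = depth_count T k"
  by (induction k) (auto simp: depth_count_0 depth_count_Suc easts_level_word)

lemma norths_zeta_prefix: "norths (zeta_prefix T k) = depth_count T (Suc k)"
  by (induction k) (auto simp: depth_count_0 depth_count_Suc norths_level_word)

text \<open>The first visited node has depth 1, so depth \<open>k\<close> is met before depth
  \<open>k + 1\<close>. Therefore the north run before the word stops at the cut, and no valley
  arises at the cut between two words.\<close>

lemma level_word_Cons:
  assumes "0 < k" "k \<le> height T"
  shows "\<exists>s. level_word T k = East # s"
proof -
  have "two_levels T k \<noteq> []"
    using level_nonempty[OF assms(2)] filter_two_levels(1)[OF assms(1), of T] by auto
  then obtain u us where us: "two_levels T k = u # us"
    by (cases "two_levels T k") auto
  then obtain v vs where vs: "rl_nodes T = v # vs"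
    by (cases "rl_nodes T") (auto simp: two_levels_def)
  have "length v = 1"
    using hd_rl_nodes[of T] vs by simp
  have "filter (\<lambda>a. a = k \<or> a = Suc k) (map length (rl_nodes T)) = map length (two_levels T k)"
    by (simp add: two_levels_def filter_map comp_def)
  then have "filter (\<lambda>a. a = k \<or> a = Suc k) (length v # map length vs) = length u # map length us"
    by (simp only: vs us list.map)
  moreover have "successively (\<lambda>a b. b \<le> Suc a) (length v # map length vs)"
    using rl_nodes_slow[of T] successively_map[of "\<lambda>a b. b \<le> Suc a" length "rl_nodes T"]
    by (simp add: vs)
  ultimately have "length u = k"
    using slow_list_first[of "length v" "map length vs" k] assms(1) \<open>length v = 1\<close> by simp
  then show ?thesis
    by (simp add: level_word_def us)
qed

lemma zeta_prefix_le: "k \<le> l \<Longrightarrow> \<exists>s. zeta_prefix T l = zeta_prefix T k @ s"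
  by (induction rule: dec_induct) auto

lemma zeta_path_split:
  assumes "k < height T"
  obtains s where "zeta_path T = zeta_prefix T k @ level_word T (Suc k) @ s"
  using zeta_prefix_le[of "Suc k" "height T" T] assms by (auto simp: zeta_path_def)

lemma depth_count_mono: "k \<le> l \<Longrightarrow> depth_count T k \<le> depth_count T l"
  by (induction rule: dec_induct) (simp_all add: depth_count_Suc)

lemma depth_count_strict_mono: "k < l \<Longrightarrow> l \<le> height T \<Longrightarrow> depth_count T k < depth_count T l"
proof -
  assume kl: "k < l" "l \<le> height T"
  then have "depth_count T k < depth_count T (Suc k)"
    using level_nonempty[of "Suc k" T] by (simp add: depth_count_Suc)
  also have "\<dots> \<le> depth_count T l"
    using kl by (intro depth_count_mono) simp
  finally show ?thesis .
qed

lemma zeta_prefix_above_diagonal: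
  "(x, y) \<in> points (zeta_prefix T k) \<Longrightarrow> x \<le> y"
proof (induction k)
  case 0
  then obtain p s where "zeta_prefix T 0 = p @ s" "easts p = x"
    by (auto simp: points_iff)
  then have "easts p + easts s = 0"
    by (metis count_list_append count_replicate_step(2) zeta_prefix.simps(1))
  then show ?case
    using \<open>easts p = x\<close> by simp
next
  case (Suc k)
  then obtain p s where ps: "zeta_prefix T k @ level_word T (Suc k) = p @ s" "easts p = x" "norths p = y"
    by (auto simp: points_iff)
  then consider (1) t where "zeta_prefix T k = p @ t"
    | (2) t where "p = zeta_prefix T k @ t" "level_word T (Suc k) = t @ s"
    by (auto simp: append_eq_append_conv2)
  then show ?case
  proof cases
    case 1
    then have "(x, y) \<in> points (zeta_prefix T k)"
      using ps by (auto simp: points_iff)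
    then show ?thesis
      by (rule Suc.IH)
  next
    case 2
    \<comment> \<open>Inside this word the abscissa never exceeds
      \<open>depth_count T (Suc k)\<close>, which is the height at which the word starts.\<close>
    have "easts t + easts s = length (level T (Suc k))"
      using easts_level_word[of "Suc k" T] 2(2) by simp
    then have "x \<le> depth_count T (Suc k)"
      using ps(2) 2(1) by (simp add: easts_zeta_prefix depth_count_Suc)
    also have "\<dots> \<le> y"
      using ps(3) 2(1) by (simp add: norths_zeta_prefix)
    finally show ?thesis .
  qed
qed

lemma zeta_path_in_Dyck: "zeta_path T \<in> Dyck (length (nonroot_nodes T))"
proof -
  have "depth_count T (Suc (height T)) = depth_count T (height T)"
    by (simp add: depth_count_Suc level_above_height)
  then show ?thesis
    using zeta_prefix_above_diagonal[of _ _ T "height T"]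
    by (auto simp: Dyck_def endpoint_def zeta_path_def easts_zeta_prefix norths_zeta_prefix
        depth_count_height)
qed

text \<open>The next word starts with an east-step, so the path leaves the column
  \<open>depth_count T k\<close> at height \<open>depth_count T (Suc k)\<close>: this is one bounce.
  The induction runs downwards from \<open>height T\<close>, where the recursion stops.\<close>

lemma bounce_from_zeta_path:
  assumes "k \<le> height T"
  shows "bounce_from (length (nonroot_nodes T)) (zeta_path T) (depth_count T k) =
    composition_path (drop k (profile T))"
  using assms
proof (induction rule: inc_induct)
  case base
  then show ?case
    by (subst bounce_from.simps) (simp add: depth_count_height composition_path_def)
next
  case (step k)
  obtain s where "zeta_path T = zeta_prefix T k @ level_word T (Suc k) @ s"
    using zeta_path_split[OF step.hyps(2)] .
  moreover obtain t where "level_word T (Suc k) = East # t"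
    using level_word_Cons[of "Suc k" T] step.hyps by auto
  ultimately have "zeta_path T = zeta_prefix T k @ East # (t @ s)"
    by simp
  from height_at_before_east[OF this]
  have height: "height_at (zeta_path T) (depth_count T k) = depth_count T (Suc k)"
    by (simp add: easts_zeta_prefix norths_zeta_prefix)
  have "drop k (profile T) = length (level T (Suc k)) # drop (Suc k) (profile T)"
    using step.hyps by (metis Cons_nth_drop_Suc length_profile nth_profile)
  moreover have "depth_count T k < depth_count T (height T)"
    using step.hyps by (intro depth_count_strict_mono) auto
  moreover have "depth_count T k < depth_count T (Suc k)"
    using step.hyps by (intro depth_count_strict_mono) auto
  moreover have "depth_count T (Suc k) - depth_count T k = length (level T (Suc k))"
    by (simp add: depth_count_Suc)
  ultimately show ?case
    by (subst bounce_from.simps)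
      (simp add: Let_def height step.IH depth_count_height composition_path_def)
qed

lemma bounce_path_zeta_path:
  "bounce_path (length (nonroot_nodes T)) (zeta_path T) = composition_path (profile T)"
  using bounce_from_zeta_path[of 0 T] by (simp add: bounce_path_def depth_count_0)

section \<open>Points and diagonal contacts of a bounce path\<close>

lemma composition_path_append: "composition_path (\<alpha> @ \<beta>) = composition_path \<alpha> @ composition_path \<beta>"
  by (simp add: composition_path_def)

lemma easts_composition_path: "easts (composition_path \<alpha>) = sum_list \<alpha>"
  by (induction \<alpha>) (auto simp: composition_path_def)

lemma norths_composition_path: "norths (composition_path \<alpha>) = sum_list \<alpha>"
  by (induction \<alpha>) (auto simp: composition_path_def)

lemma replicate_eq_append: "replicate a s = p @ q \<Longrightarrow> \<exists>m\<le>a. p = replicate m s"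
proof -
  assume "replicate a s = p @ q"
  then have "p = replicate (min (length p) a) s"
    by (metis append_eq_conv_conj take_replicate)
  then show ?thesis
    by (metis min.cobounded2)
qed

text \<open>A point lies on the north run or on the east run of some block. For an empty composition
  the origin would belong to no block.\<close>

lemma points_composition_path:
  assumes "(x, y) \<in> points (composition_path \<alpha>)" "\<alpha> \<noteq> []"
  defines "s \<equiv> \<lambda>k. sum_list (take k \<alpha>)"
  shows "\<exists>k<length \<alpha>. (x = s k \<and> s k \<le> y \<and> y \<le> s (Suc k)) \<or> (y = s (Suc k) \<and> s k \<le> x \<and> x \<le> s (Suc k))"
  using assms(1,2) unfolding s_def
proof (induction \<alpha> rule: rev_induct)
  case (snoc a \<alpha>)
  obtain p q where pq: "composition_path \<alpha> @ replicate a North @ replicate a East = p @ q"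
    "easts p = x" "norths p = y"
    using snoc.prems by (auto simp: points_iff composition_path_append) (auto simp: composition_path_def)
  have new: ?case if "(x = sum_list \<alpha> \<and> sum_list \<alpha> \<le> y \<and> y \<le> sum_list \<alpha> + a) \<or>
      (y = sum_list \<alpha> + a \<and> sum_list \<alpha> \<le> x \<and> x \<le> sum_list \<alpha> + a)"
    using that by (intro exI[of _ "length \<alpha>"]) auto
  from pq(1) consider (1) t where "composition_path \<alpha> = p @ t"
    | (2) t where "p = composition_path \<alpha> @ t" "replicate a North @ replicate a East = t @ q"
    by (auto simp: append_eq_append_conv2)
  then show ?case
  proof cases
    case 1
    show ?thesis
    proof (cases "\<alpha> = []")
      case True
      then have "x = 0" "y = 0"
        using 1 pq by (auto simp: composition_path_def)
      then show ?thesis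
        using new True by simp
    next
      case False
      have "(x, y) \<in> points (composition_path \<alpha>)"
        using 1 pq by (auto simp: points_iff)
      then obtain k where k: "k < length \<alpha>" "(x = sum_list (take k \<alpha>) \<and> sum_list (take k \<alpha>) \<le> y \<and>
          y \<le> sum_list (take (Suc k) \<alpha>)) \<or> (y = sum_list (take (Suc k) \<alpha>) \<and>
          sum_list (take k \<alpha>) \<le> x \<and> x \<le> sum_list (take (Suc k) \<alpha>))"
        using snoc.IH False by blast
      then show ?thesis
        by (intro exI[of _ k]) auto
    qed
  next
    case 2
    have xy: "x = sum_list \<alpha> + easts t" "y = sum_list \<alpha> + norths t"
      using 2(1) pq by (simp_all add: easts_composition_path norths_composition_path)
    from 2(2) consider (N) r where "replicate a North = t @ r"
      | (E) r where "t = replicate a North @ r" "replicate a East = r @ q"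
      by (auto simp: append_eq_append_conv2)
    then show ?thesis
    proof cases
      case N
      then obtain m where "t = replicate m North" "m \<le> a"
        using replicate_eq_append[OF N] by metis
      then show ?thesis
        using new xy by simp
    next
      case E
      then obtain m where "r = replicate m East" "m \<le> a"
        using replicate_eq_append[OF E(2)] by metis
      then show ?thesis
        using new xy E(1) by simp
    qed
  qed
qed simp

text \<open>A north run has constant abscissa \<open>s k\<close> and an east run constant ordinate
  \<open>s (Suc k)\<close>, in terms of the partial sums \<open>s\<close>; so a diagonal point is an
  end of a block.\<close>

lemma sorted_list_of_set_diagonal:
  assumes "0 < height T"
  shows "sorted_list_of_set {x. (x, x) \<in> points (composition_path (profile T))} =
    map (depth_count T) [0..<Suc (height T)]"
proof -
  let ?h = "height T" and ?S = "depth_count T"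
  have "{x. (x, x) \<in> points (composition_path (profile T))} = ?S ` {0..<Suc ?h}"
  proof (intro equalityI subsetI)
    fix x assume "x \<in> {x. (x, x) \<in> points (composition_path (profile T))}"
    then obtain k where "k < ?h"
      "x = sum_list (take k (profile T)) \<or> x = sum_list (take (Suc k) (profile T))"
      using points_composition_path[of x x "profile T"] assms by (auto simp flip: length_greater_0_conv)
    then have "x = ?S k \<or> x = ?S (Suc k)"
      using sum_take_profile[of k T] sum_take_profile[of "Suc k" T] by simp
    then show "x \<in> ?S ` {0..<Suc ?h}"
      using \<open>k < ?h\<close> by auto
  next
    fix x assume "x \<in> ?S ` {0..<Suc ?h}"
    then obtain k where "k < Suc ?h" and x: "x = ?S k"
      by auto
    then have k: "k \<le> ?h"
      by simp
    have "composition_path (profile T) =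
        composition_path (take k (profile T)) @ composition_path (drop k (profile T))"
      by (metis append_take_drop_id composition_path_append)
    then show "x \<in> {x. (x, x) \<in> points (composition_path (profile T))}"
      using x sum_take_profile[OF k] easts_composition_path[of "take k (profile T)"]
        norths_composition_path[of "take k (profile T)"] unfolding mem_Collect_eq points_iff by metis
  qed
  then have "{x. (x, x) \<in> points (composition_path (profile T))} = set (map ?S [0..<Suc ?h])"
    by (simp only: set_map set_upt)
  moreover have "sorted_wrt (<) (map ?S [0..<Suc ?h])"
    unfolding sorted_wrt_iff_nth_less using depth_count_strict_mono[of _ _ T]
    by (auto simp del: upt_Suc)
  ultimately show ?thesis
    by (simp only: strict_sorted_iff sorted_list_of_set.idem_if_sorted_distinct)
qed

lemma bounce_params_zeta_path:
  "0 < height T \<Longrightarrow> bounce_params (length (nonroot_nodes T)) (zeta_path T) =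
    map (depth_count T) [0..<Suc (height T)]"
  by (simp only: bounce_params_def bounce_path_zeta_path sorted_list_of_set_diagonal)

section \<open>Valleys and the zeta map\<close>

text \<open>The second word starts with \<open>East\<close>, so no pair \<open>East\<close>,
  \<open>North\<close> straddles the cut.\<close>

lemma valleys_append_East:
  "(x, y) \<in> valleys (u @ East # v) \<longleftrightarrow> (x, y) \<in> valleys u \<or>
    (\<exists>x' y'. (x', y') \<in> valleys (East # v) \<and> x = easts u + x' \<and> y = norths u + y')"
proof
  assume "(x, y) \<in> valleys (u @ East # v)"
  then obtain p s where ps: "u @ East # v = p @ East # North # s" "x = Suc (easts p)" "y = norths p"
    by (auto simp: valleys_iff)
  from ps(1) consider (1) t where "u = p @ t" "t @ East # v = East # North # s"
    | (2) t where "p = u @ t" "East # v = t @ East # North # s"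
    by (auto simp: append_eq_append_conv2)
  then show "(x, y) \<in> valleys u \<or>
    (\<exists>x' y'. (x', y') \<in> valleys (East # v) \<and> x = easts u + x' \<and> y = norths u + y')"
  proof cases
    case 1
    show ?thesis
    proof (cases t)
      case Nil
      then have "(1, 0) \<in> valleys (East # v)"
        using 1 unfolding valleys_iff by (intro exI[of _ "[]"] exI[of _ s]) simp
      then show ?thesis
        using ps 1 Nil by fastforce
    next
      case (Cons a t')
      then obtain t'' where "t = East # North # t''"
        using 1(2) by (cases t') auto
      then have "(x, y) \<in> valleys u"
        using 1 ps by (auto simp: valleys_iff)
      then show ?thesis ..
    qed
  next
    case 2
    then have "(Suc (easts t), norths t) \<in> valleys (East # v)"
      by (auto simp: valleys_iff)
    then show ?thesis
      using ps 2(1) by fastforce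
  qed
next
  assume "(x, y) \<in> valleys u \<or>
    (\<exists>x' y'. (x', y') \<in> valleys (East # v) \<and> x = easts u + x' \<and> y = norths u + y')"
  then show "(x, y) \<in> valleys (u @ East # v)"
  proof
    assume "(x, y) \<in> valleys u"
    then obtain p s where "u = p @ East # North # s" "x = Suc (easts p)" "y = norths p"
      by (auto simp: valleys_iff)
    moreover from this(1) have "u @ East # v = p @ East # North # (s @ East # v)"
      by simp
    ultimately show ?thesis
      unfolding valleys_iff by blast
  next
    assume "\<exists>x' y'. (x', y') \<in> valleys (East # v) \<and> x = easts u + x' \<and> y = norths u + y'"
    then obtain p s where "East # v = p @ East # North # s" "x = easts u + Suc (easts p)"
      "y = norths u + norths p"
      by (auto simp: valleys_iff)
    then have "u @ East # v = (u @ p) @ East # North # s" "x = Suc (easts (u @ p))"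
      "y = norths (u @ p)"
      by simp_all
    then show ?thesis
      unfolding valleys_iff by blast
  qed
qed

lemma valleys_replicate_North: "valleys (replicate m North) = {}"
proof -
  have False if "replicate m North = p @ East # s" for p s
  proof -
    have "East \<in> set (replicate m North)"
      by (simp only: that) simp
    then show False
      by simp
  qed
  then have "(x, y) \<notin> valleys (replicate m North)" for x y
    unfolding valleys_iff by metis
  then show ?thesis
    by auto
qed

lemma valleys_zeta_prefix:
  "k \<le> height T \<Longrightarrow> (x, y) \<in> valleys (zeta_prefix T k) \<longleftrightarrow>
    (\<exists>j<k. \<exists>x' y'. (x', y') \<in> valleys (level_word T (Suc j)) \<and>
      x = depth_count T j + x' \<and> y = depth_count T (Suc j) + y')"
proof (induction k)
  case 0
  then show ?case
    by (simp add: valleys_replicate_North)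
next
  case (Suc k)
  obtain s where s: "level_word T (Suc k) = East # s"
    using level_word_Cons[of "Suc k" T] Suc.prems by auto
  have "(x, y) \<in> valleys (zeta_prefix T (Suc k)) \<longleftrightarrow> (x, y) \<in> valleys (zeta_prefix T k) \<or>
    (\<exists>x' y'. (x', y') \<in> valleys (level_word T (Suc k)) \<and>
      x = depth_count T k + x' \<and> y = depth_count T (Suc k) + y')"
    by (simp add: s valleys_append_East easts_zeta_prefix norths_zeta_prefix)
  then show ?case
    using Suc by (auto simp: less_Suc_eq)
qed

lemma valleys_level_word:
  "(x, y) \<in> valleys (level_word T k) \<longleftrightarrow>
    (\<exists>us u v vs. two_levels T k = us @ u # v # vs \<and> length u = k \<and> length v = Suc k \<and>
      x = Suc (length (filter (\<lambda>u. length u = k) us)) \<and>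
      y = length (filter (\<lambda>u. length u = Suc k) us))"
  (is "?L \<longleftrightarrow> ?R")
proof -
  let ?f = "\<lambda>u::node. if length u = k then East else North"
  have norths: "norths (map ?f us) = length (filter (\<lambda>u. length u = Suc k) us)"
    if "two_levels T k = us @ ws" for us ws
    by (rule norths_map_level) (use that in_two_levels[of _ T k] in auto)
  show ?thesis
  proof
    assume ?L
    then obtain p s where ps: "map ?f (two_levels T k) = p @ East # North # s"
      "x = Suc (easts p)" "y = norths p"
      by (auto simp: valleys_iff level_word_def)
    then obtain us u v vs where split: "two_levels T k = us @ u # v # vs" "p = map ?f us"
      "?f u = East" "?f v = North"
      by (auto simp: map_eq_append_conv map_eq_Cons_conv)
    have "v \<in> set (two_levels T k)"
      by (simp add: split(1))
    then have "length v = Suc k"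
      using in_two_levels[of v T k] split(4) by (auto split: if_splits)
    moreover have "length u = k"
      using split(3) by (auto split: if_splits)
    ultimately show ?R
      using split(1,2) ps norths[OF split(1)] easts_map_level[of k us] by blast
  next
    assume ?R
    then obtain us u v vs where split: "two_levels T k = us @ u # v # vs" "length u = k"
      "length v = Suc k" "x = Suc (length (filter (\<lambda>u. length u = k) us))"
      "y = length (filter (\<lambda>u. length u = Suc k) us)"
      by blast
    have "level_word T k = map ?f us @ East # North # map ?f vs"
      using split by (simp add: level_word_def)
    then show ?L
      using split(4,5) norths[OF split(1)] easts_map_level[of k us] unfolding valleys_iff by metis
  qed
qed

section \<open>Neighbours in the list of two consecutive levels\<close>

lemma rl_nodes_successor:
  assumes "rl_nodes T = us @ u # v # vs"
  shows "rl_successor T u v"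
  using successively_rl_nodes[of T] by (simp add: assms successively_Cons successively_append_iff)

text \<open>The rightmost child is visited right after its parent, and filtering keeps both, so they
  stay adjacent.\<close>

lemma two_levels_internal:
  assumes "internal T u"
  shows "\<exists>us vs. two_levels T (length u) = us @ u # rightmost_child T u # vs"
proof -
  have u: "u \<in> set (rl_nodes T)" "children (subtree T u) \<noteq> []"
    using assms by (simp_all add: internal_def set_rl_nodes)
  then obtain us ws where split: "rl_nodes T = us @ u # ws"
    by (meson split_list)
  have "ws \<noteq> []"
    using successively_rl_nodes[of T] u(2) by (auto simp: split)
  then obtain v vs where ws: "ws = v # vs"
    by (cases ws) auto
  then have "v = rightmost_child T u"
    using rl_nodes_successor[of T us u v vs] split u(2) by (simp add: rl_successor_def)
  then show ?thesis
    by (auto simp: two_levels_def split ws rightmost_child_def)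
qed

text \<open>If other nodes were visited between \<open>u\<close> and \<open>v\<close>, the first of
  them would have depth below \<open>k\<close>, as it is not a child of \<open>u\<close>. Climbing
  from there to depth \<open>Suc k\<close> would pass through depth \<open>k\<close> before
  \<open>v\<close>, contradicting adjacency in the filtered list. So \<open>v\<close> directly
  follows \<open>u\<close> and is deeper.\<close>

lemma two_levels_successor:
  assumes "two_levels T k = us @ u # v # vs" "length u = k" "length v = Suc k"
  shows "internal T u" "v = rightmost_child T u"
proof -
  let ?P = "\<lambda>u::node. length u = k \<or> length u = Suc k"
  have append: "\<exists>as bs. ws = as @ bs \<and> filter ?P bs = zs" if "filter ?P ws = ys @ zs" for ws ys zs
    using that
  proof (induction ys arbitrary: ws)
    case (Cons y ys)
    then obtain cs ds where cd: "ws = cs @ y # ds" "filter ?P ds = ys @ zs"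
      using filter_eq_ConsD[of ?P ws y "ys @ zs"] by auto
    then obtain as bs where "ds = as @ bs" "filter ?P bs = zs"
      using Cons.IH by blast
    then show ?case
      using cd by (intro exI[of _ "cs @ y # as"] exI[of _ bs]) simp
  qed (auto intro: exI[of _ "[]"])
  obtain as bs where ab: "rl_nodes T = as @ bs" "filter ?P bs = u # v # vs"
    using assms(1) append unfolding two_levels_def by blast
  obtain cs ds where cd: "bs = cs @ u # ds" "v # vs = filter ?P ds"
    using filter_eq_ConsD[OF ab(2)] by blast
  obtain es fs where ef: "ds = es @ v # fs" "\<forall>w\<in>set es. \<not> ?P w"
    using filter_eq_ConsD[OF cd(2)[symmetric]] by blast
  have split: "rl_nodes T = (as @ cs) @ u # es @ v # fs"
    by (simp add: ab(1) cd(1) ef(1))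
  have "children (subtree T u) \<noteq> [] \<and> v = rightmost_child T u"
  proof (cases es)
    case Nil
    then have "rl_successor T u v"
      using rl_nodes_successor[of T "as @ cs" u v fs] split by simp
    then show ?thesis
      using assms(2,3) by (auto simp: rl_successor_def split: if_splits)
  next
    case (Cons w es')
    then have "rl_successor T u w"
      using rl_nodes_successor[of T "as @ cs" u w "es' @ v # fs"] split by simp
    moreover have w: "length w \<noteq> k" "length w \<noteq> Suc k"
      using ef(2) Cons by auto
    ultimately have "length w \<le> k"
      using assms(2) by (auto simp: rl_successor_def rightmost_child_def split: if_splits)
    have "successively (\<lambda>u v. length v \<le> Suc (length u)) ((as @ cs @ [u]) @ (w # es' @ [v]) @ fs)"
      using rl_nodes_slow[of T] split Cons by simp
    then have "successively (\<lambda>u v. length v \<le> Suc (length u)) (w # es' @ [v])"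
      by (simp only: successively_append_iff)
    then have "successively (\<lambda>a b. b \<le> Suc a) (map length (w # es' @ [v]))"
      by (simp only: successively_map)
    then have "k \<in> length ` set (w # es')"
      using slow_list_passes[of "length w" "map length es'" k] \<open>length w \<le> k\<close> assms(3) by simp
    then show ?thesis
      using ef(2) Cons by auto
  qed
  moreover have "u \<in> set (nonroot_nodes T)"
    using split by (simp flip: set_rl_nodes)
  ultimately show "internal T u" "v = rightmost_child T u"
    by (simp_all add: internal_def)
qed

section \<open>Marked points and valleys\<close>

lemma is_nth_append: "is_nth (xs @ x # ys) (Suc (length xs)) x"
  by (simp add: is_nth_def)

lemma is_nth_unique:
  assumes "distinct xs" "is_nth xs i x" "is_nth xs j x"
  shows "i = j"
proof -
  have "i - 1 < length xs" "j - 1 < length xs" "xs ! (i - 1) = xs ! (j - 1)"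
    using assms by (auto simp: is_nth_def)
  then have "i - 1 = j - 1"
    using assms(1) by (simp only: nth_eq_iff_index_eq)
  then show ?thesis
    using assms unfolding is_nth_def by linarith
qed

lemma color_class_profile: "0 < k \<Longrightarrow> color_class T (profile T) k = level T k"
  by (cases k) (auto simp: color_class_def level_Suc color_profile intro!: filter_cong)

lemma active_after_profile: "k \<le> height T \<Longrightarrow> active_after T (profile T) k = level T (Suc k)"
  by (simp add: active_after_def coloring_profile active_depth_coloring)

text \<open>Positions are counted from the left, while the words run from right to left: the nodes
  counted before \<open>u\<close> or \<open>v\<close> in their levels are those in
  \<open>vs\<close>.\<close>

lemma two_levels_positions:
  assumes "0 < k" "two_levels T k = us @ u # v # vs" "length u = k" "length v = Suc k"
  defines "m \<equiv> \<lambda>k ws. length (filter (\<lambda>u::node. length u = k) ws)"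
  shows "is_nth (level T k) (Suc (m k vs)) u" "is_nth (level T (Suc k)) (Suc (m (Suc k) vs)) v"
    and "length (level T k) = Suc (m k us + m k vs)"
    and "length (level T (Suc k)) = Suc (m (Suc k) us + m (Suc k) vs)"
proof -
  have "rev (level T k) = filter (\<lambda>u. length u = k) us @ u # filter (\<lambda>u. length u = k) vs"
    using filter_two_levels(1)[OF assms(1), of T] assms(2-4) by simp
  then have k: "level T k =
      rev (filter (\<lambda>u. length u = k) vs) @ u # rev (filter (\<lambda>u. length u = k) us)"
    by (simp add: rev_swap)
  have "rev (level T (Suc k)) =
      filter (\<lambda>u. length u = Suc k) us @ v # filter (\<lambda>u. length u = Suc k) vs"
    using filter_two_levels(2)[OF assms(1), of T] assms(2-4) by simp
  then have Suc_k: "level T (Suc k) =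
      rev (filter (\<lambda>u. length u = Suc k) vs) @ v # rev (filter (\<lambda>u. length u = Suc k) us)"
    by (simp add: rev_swap)
  show "is_nth (level T k) (Suc (m k vs)) u" "is_nth (level T (Suc k)) (Suc (m (Suc k) vs)) v"
    using is_nth_append[of "rev (filter (\<lambda>u. length u = k) vs)" u]
      is_nth_append[of "rev (filter (\<lambda>u. length u = Suc k) vs)" v]
    by (simp_all add: k Suc_k m_def)
  show "length (level T k) = Suc (m k us + m k vs)"
    "length (level T (Suc k)) = Suc (m (Suc k) us + m (Suc k) vs)"
    by (simp_all add: k Suc_k m_def)
qed

text \<open>A valley is an east-step of some \<open>u\<close> followed by a north-step of some
  \<open>v\<close> within one level word, and such neighbours are exactly the internal nodes with
  their rightmost children.\<close>

lemma valleys_zeta_path: "valleys (zeta_path T) = marked_points T (profile T)"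
proof -
  have valley_iff: "(x, y) \<in> valleys (zeta_path T) \<longleftrightarrow>
    (\<exists>k us u v vs. 0 < k \<and> k \<le> height T \<and> two_levels T k = us @ u # v # vs \<and> length u = k \<and>
      length v = Suc k \<and> x = depth_count T (k - 1) + Suc (length (filter (\<lambda>u. length u = k) us)) \<and>
      y = depth_count T k + length (filter (\<lambda>u. length u = Suc k) us))" (is "_ \<longleftrightarrow> ?R") for x y
  proof
    assume "(x, y) \<in> valleys (zeta_path T)"
    then obtain j x' y' where "j < height T" "(x', y') \<in> valleys (level_word T (Suc j))"
      "x = depth_count T j + x'" "y = depth_count T (Suc j) + y'"
      using valleys_zeta_prefix[of "height T" T x y] by (auto simp: zeta_path_def)
    then show ?R
      unfolding valleys_level_word by (intro exI[of _ "Suc j"]) auto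
  next
    assume ?R
    then obtain k us u v vs where k: "0 < k" "k \<le> height T" "two_levels T k = us @ u # v # vs"
      "length u = k" "length v = Suc k"
      "x = depth_count T (k - 1) + Suc (length (filter (\<lambda>u. length u = k) us))"
      "y = depth_count T k + length (filter (\<lambda>u. length u = Suc k) us)"
      by blast
    then obtain j where j: "k = Suc j"
      by (cases k) auto
    have "(Suc (length (filter (\<lambda>u. length u = k) us)), length (filter (\<lambda>u. length u = Suc k) us))
        \<in> valleys (level_word T (Suc j))"
      unfolding valleys_level_word j[symmetric] using k(3-5) by blast
    moreover have "j < height T"
      "x = depth_count T j + Suc (length (filter (\<lambda>u. length u = k) us))"
      "y = depth_count T (Suc j) + length (filter (\<lambda>u. length u = Suc k) us)"
      using k(2,6,7) j by simp_all
    ultimately show "(x, y) \<in> valleys (zeta_path T)"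
      unfolding zeta_path_def valleys_zeta_prefix[OF order_refl] by blast
  qed
  \<comment> \<open>Here \<open>i\<close> and \<open>j\<close> are replaced by one plus the number
    of nodes of the respective depth in \<open>vs\<close>. Subtracting a position counted from the
    left from the end of a level leaves the number of nodes of that level in
    \<open>us\<close>.\<close>
  have position: "sum_list (take k (profile T)) - Suc (length (filter (\<lambda>u. length u = k) vs)) + 1 =
      depth_count T (k - 1) + Suc (length (filter (\<lambda>u. length u = k) us))"
    "sum_list (take k (profile T)) + length (active_after T (profile T) k) -
      Suc (length (filter (\<lambda>u. length u = Suc k) vs)) =
      depth_count T k + length (filter (\<lambda>u. length u = Suc k) us)"
    if k: "0 < k" "k \<le> height T" "two_levels T k = us @ u # v # vs" "length u = k" "length v = Suc k"
    for k us u v vs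
  proof -
    have "depth_count T k = depth_count T (k - 1) + length (level T k)"
      using depth_count_Suc[of T "k - 1"] k(1) by simp
    then show "sum_list (take k (profile T)) - Suc (length (filter (\<lambda>u. length u = k) vs)) + 1 =
        depth_count T (k - 1) + Suc (length (filter (\<lambda>u. length u = k) us))"
      "sum_list (take k (profile T)) + length (active_after T (profile T) k) -
        Suc (length (filter (\<lambda>u. length u = Suc k) vs)) =
        depth_count T k + length (filter (\<lambda>u. length u = Suc k) us)"
      using two_levels_positions(3,4)[OF k(1,3-5)] k(2)
      by (simp_all add: sum_take_profile active_after_profile)
  qed
  have "(x, y) \<in> valleys (zeta_path T) \<longleftrightarrow> (x, y) \<in> marked_points T (profile T)" for x y
  proof
    assume "(x, y) \<in> valleys (zeta_path T)"
    then obtain k us u v vs where k: "0 < k" "k \<le> height T" "two_levels T k = us @ u # v # vs"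
      "length u = k" "length v = Suc k"
      and x: "x = depth_count T (k - 1) + Suc (length (filter (\<lambda>u. length u = k) us))"
      and y: "y = depth_count T k + length (filter (\<lambda>u. length u = Suc k) us)"
      using valley_iff by blast
    have u: "internal T u" "v = rightmost_child T u"
      using two_levels_successor[OF k(3-5)] by auto
    have color: "color T (profile T) u = k"
      using u(1) k(4) by (simp add: internal_def color_profile)
    have nth: "is_nth (color_class T (profile T) k) (Suc (length (filter (\<lambda>u. length u = k) vs))) u"
      "is_nth (active_after T (profile T) k) (Suc (length (filter (\<lambda>u. length u = Suc k) vs)))
        (rightmost_child T u)"
      using two_levels_positions(1,2)[OF k(1,3-5)] k(1,2) u(2)
      by (simp_all add: color_class_profile active_after_profile)
    show "(x, y) \<in> marked_points T (profile T)"
      unfolding marked_points_def x y position[OF k, symmetric]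
      using u(1) color nth by blast
  next
    assume "(x, y) \<in> marked_points T (profile T)"
    then obtain u k i j where u: "internal T u" "color T (profile T) u = k"
      and nth: "is_nth (color_class T (profile T) k) i u"
        "is_nth (active_after T (profile T) k) j (rightmost_child T u)"
      and x: "x = sum_list (take k (profile T)) - i + 1"
      and y: "y = sum_list (take k (profile T)) + length (active_after T (profile T) k) - j"
      unfolding marked_points_def by blast
    have node: "u \<in> set (nonroot_nodes T)"
      using u(1) by (simp add: internal_def)
    have len: "length u = k"
      using u(2) color_profile[OF node] by simp
    have k: "0 < k" "k \<le> height T"
      using node length_le_height[of u T] by (auto simp: in_nonroot_nodes_iff len[symmetric])
    obtain us vs where split: "two_levels T k = us @ u # rightmost_child T u # vs"
      using two_levels_internal[OF u(1)] len by auto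
    have child: "length (rightmost_child T u) = Suc k"
      by (simp add: rightmost_child_def len)
    have "i = Suc (length (filter (\<lambda>u. length u = k) vs))"
      using two_levels_positions(1)[OF k(1) split len child] nth(1) distinct_level k(1)
      by (intro is_nth_unique[of "level T k"]) (simp_all add: color_class_profile)
    moreover have "j = Suc (length (filter (\<lambda>u. length u = Suc k) vs))"
      using two_levels_positions(2)[OF k(1) split len child] nth(2) distinct_level k(2)
      by (intro is_nth_unique[of "level T (Suc k)"]) (simp_all add: active_after_profile)
    ultimately show "(x, y) \<in> valleys (zeta_path T)"
      unfolding valley_iff x y using position[OF k split len child] k split len child by blast
  qed
  then show ?thesis
    by auto
qed

lemma Xi_bounce_profile: "Xi_bounce (T, profile T) = (composition_path (profile T), zeta_path T)"
proof -
  have "(THE \<mu>. \<mu> \<in> Dyck (length (nonroot_nodes T)) \<and> valleys \<mu> = marked_points T (profile T)) =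
      zeta_path T"
    by (rule the_equality)
      (auto simp: zeta_path_in_Dyck valleys_zeta_path[symmetric] intro: Dyck_eq_if_valleys_eq)
  then show ?thesis
    by (simp add: Xi_bounce_def)
qed

text \<open>For nestedness: each point \<open>(x, y)\<close> of the bounce path satisfies
  \<open>depth_count T k \<le> x\<close> and \<open>y \<le> depth_count T (Suc k)\<close> for some
  \<open>k\<close>, and the upper path, having passed through the point with these two coordinates,
  is at least that high in column \<open>x\<close>.\<close>

lemma bounce_pair_zeta_path_in_BP:
  fixes T
  defines "n \<equiv> length (nonroot_nodes T)"
  assumes "0 < n"
  shows "(bounce_path n (zeta_path T), zeta_path T) \<in> BP n"
proof -
  let ?\<alpha> = "profile T"
  have "?\<alpha> \<noteq> []"
    using assms(2) composition_profile[of T] by (auto simp: n_def composition_def)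
  have point: "\<exists>k<height T. x \<le> y \<and> x \<le> n \<and> depth_count T k \<le> x \<and> y \<le> depth_count T (Suc k)"
    if xy: "(x, y) \<in> points (composition_path ?\<alpha>)" for x y
  proof -
    obtain k where k: "k < height T"
      "(x = sum_list (take k ?\<alpha>) \<and> sum_list (take k ?\<alpha>) \<le> y \<and> y \<le> sum_list (take (Suc k) ?\<alpha>)) \<or>
       (y = sum_list (take (Suc k) ?\<alpha>) \<and> sum_list (take k ?\<alpha>) \<le> x \<and> x \<le> sum_list (take (Suc k) ?\<alpha>))"
      using points_composition_path[OF xy \<open>?\<alpha> \<noteq> []\<close>] by auto
    moreover have "depth_count T (Suc k) \<le> n"
      using k(1) depth_count_mono[of "Suc k" "height T" T] by (simp add: n_def depth_count_height)
    moreover have "depth_count T k \<le> depth_count T (Suc k)"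
      by (intro depth_count_mono) simp
    ultimately show ?thesis
      using sum_take_profile[of k T] sum_take_profile[of "Suc k" T] by (intro exI[of _ k]) auto
  qed
  have "sum_list ?\<alpha> = n"
    using composition_profile[of T] by (simp add: composition_def n_def)
  then have "composition_path ?\<alpha> \<in> Dyck n"
    using point by (auto simp: Dyck_def endpoint_def easts_composition_path norths_composition_path)
  moreover have "bounce (composition_path ?\<alpha>)"
    using composition_profile[of T] by (auto simp: bounce_def composition_def)
  moreover have "nested (composition_path ?\<alpha>) (zeta_path T)"
    unfolding nested_def
  proof
    fix q assume "q \<in> points (composition_path ?\<alpha>)"
    moreover obtain x y where q: "q = (x, y)"
      by (cases q)
    ultimately obtain k where k: "k < height T" "x \<le> n" "depth_count T k \<le> x"
      "y \<le> depth_count T (Suc k)"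
      using point by blast
    obtain s where s: "zeta_path T = zeta_prefix T k @ s"
      using zeta_path_split[OF k(1)] by metis
    have "depth_count T k + easts s = n"
      using zeta_path_in_Dyck[of T] by (simp add: s Dyck_iff n_def easts_zeta_prefix)
    then have "x - depth_count T k \<le> easts s"
      using k(2) by linarith
    then obtain p t where "s = p @ t" "easts p = x - depth_count T k"
      using ex_prefix_easts by blast
    then have "zeta_path T = (zeta_prefix T k @ p) @ t" "easts (zeta_prefix T k @ p) = x"
      "y \<le> norths (zeta_prefix T k @ p)"
      using s k by (simp_all add: easts_zeta_prefix norths_zeta_prefix)
    then show "weakly_below q (zeta_path T)"
      unfolding weakly_below_def q fst_conv snd_conv points_iff by blast
  qed
  ultimately show ?thesis
    using zeta_path_in_Dyck[of T] by (simp add: BP_def n_def bounce_path_zeta_path)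
qed

section \<open>The inverse zeta map on paths of consecutive levels\<close>

lemma subpath_zeta_path:
  assumes "k < height T"
  shows "subpath (zeta_path T) (depth_count T k, depth_count T (Suc k))
    (depth_count T (Suc k), depth_count T (Suc (Suc k))) = level_word T (Suc k)"
proof -
  obtain s where s: "zeta_path T = zeta_prefix T k @ level_word T (Suc k) @ s"
    using zeta_path_split[OF assms] .
  have "length (zeta_prefix T k) = depth_count T k + depth_count T (Suc k)"
    by (simp add: length_eq_easts_norths easts_zeta_prefix norths_zeta_prefix)
  moreover have "length (level_word T (Suc k)) =
      length (level T (Suc k)) + length (level T (Suc (Suc k)))"
    by (simp add: length_eq_easts_norths easts_level_word norths_level_word)
  ultimately show ?thesis
    by (simp add: subpath_def s depth_count_Suc)
qed

text \<open>Area entries are depths minus one, so the index drops by one: the word of depths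
  \<open>k + 1\<close> and \<open>k + 2\<close> yields the entries \<open>k\<close> and
  \<open>k + 1\<close>, as in \<open>zeta_word\<close> for index \<open>Suc k\<close>.\<close>

lemma filter_area_vector:
  "filter (\<lambda>a. a = k \<or> a = Suc k) (map (\<lambda>u. length u - 1) (rl_nodes T)) =
    map (\<lambda>s. case s of East \<Rightarrow> k | North \<Rightarrow> Suc k) (level_word T (Suc k))"
proof -
  have "filter (\<lambda>u. length u - 1 = k \<or> length u - 1 = Suc k) (rl_nodes T) = two_levels T (Suc k)"
    unfolding two_levels_def
  proof (rule filter_cong)
    fix u assume "u \<in> set (rl_nodes T)"
    then have "0 < length u"
      using Nil_notin_rl_nodes[of T] by auto
    then show "(length u - 1 = k \<or> length u - 1 = Suc k) = (length u = Suc k \<or> length u = Suc (Suc k))"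
      by auto
  qed simp
  then have "filter (\<lambda>a. a = k \<or> a = Suc k) (map (\<lambda>u. length u - 1) (rl_nodes T)) =
      map (\<lambda>u. length u - 1) (two_levels T (Suc k))"
    by (simp add: filter_map comp_def)
  also have "\<dots> = map (\<lambda>s. case s of East \<Rightarrow> k | North \<Rightarrow> Suc k) (level_word T (Suc k))"
    unfolding level_word_def map_map
  proof (rule map_cong)
    fix u assume "u \<in> set (two_levels T (Suc k))"
    then show "length u - 1 = ((\<lambda>s. case s of East \<Rightarrow> k | North \<Rightarrow> Suc k) \<circ>
        (\<lambda>u. if length u = Suc k then East else North)) u"
      using in_two_levels[of u T "Suc k"] by auto
  qed simp
  finally show ?thesis .
qed

lemma count_area_vector:
  "count_list (map (\<lambda>u. length u - 1) (rl_nodes T)) k = length (level T (Suc k))"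
proof -
  have "count_list (map (\<lambda>u. length u - 1) us) k = length (filter (\<lambda>u. length u = Suc k) us)"
    if "[] \<notin> set us" for us :: "node list"
    using that
  proof (induction us)
    case (Cons u us)
    then show ?case
      by (cases u) auto
  qed simp
  then show ?thesis
    using Nil_notin_rl_nodes[of T] filter_rl_nodes[of "Suc k" T] by simp
qed

lemma length_filter_less_eq_sum: "length (filter (\<lambda>a::nat. a < h) xs) = (\<Sum>k<h. count_list xs k)"
proof (induction h)
  case (Suc h)
  have "length (filter (\<lambda>a. a < Suc h) xs) = length (filter (\<lambda>a. a < h) xs) + count_list xs h"
    by (induction xs) (auto simp: less_Suc_eq)
  then show ?case
    using Suc by simp
qed simp

lemma filter_eq_replicate: "filter (\<lambda>a. a = k) xs = replicate (count_list xs k) k"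
  by (induction xs) auto

text \<open>
  The counts \<open>b\<^sub>k\<^sub>+\<^sub>1 - b\<^sub>k\<close> force all entries of the area vector to be less than \<open>r\<close>, so that the
  subsequences for \<open>k \<ge> r\<close> are determined as well.
\<close>

lemma zeta_inv_zeta_path:
  fixes T
  defines "n \<equiv> length (nonroot_nodes T)"
  assumes "0 < n"
  shows "zeta_inv n (zeta_path T) = tree_path T"
proof -
  let ?h = "height T" and ?S = "depth_count T"
  let ?a = "map (\<lambda>u. length u - 1) (rl_nodes T)"
  have h: "0 < ?h"
    using assms(2) depth_count_height[of T] depth_count_0[of T] by (cases ?h) (auto simp: n_def)
  have params: "bounce_params n (zeta_path T) = map ?S [0..<Suc ?h]"
    using bounce_params_zeta_path[OF h] by (simp add: n_def)
  have b: "bounce_params n (zeta_path T) ! k = ?S k" if "k \<le> ?h" for k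
    using that by (simp add: params nth_append del: upt_Suc)
  have r: "length (bounce_params n (zeta_path T)) - 1 = ?h"
    by (simp add: params)
  have word: "zeta_word n (zeta_path T) (Suc k) = filter (\<lambda>a. a = k \<or> a = Suc k) ?a"
    if "Suc k < ?h" for k
    unfolding filter_area_vector using that subpath_zeta_path[of k T]
    by (simp add: zeta_word_def Let_def b)
  have differences: "(\<forall>k<?h. count_list xs k =
        bounce_params n (zeta_path T) ! (k + 1) - bounce_params n (zeta_path T) ! k) \<longleftrightarrow>
      (\<forall>k<?h. count_list xs k = ?S (k + 1) - ?S k)" for xs
    using b by auto
  have cond: "(\<forall>k<?h. count_list xs k = ?S (k + 1) - ?S k) \<and>
      (\<forall>k. 1 \<le> k \<and> k < ?h \<longrightarrow> filter (\<lambda>a. a \<in> {k - 1, k}) xs = zeta_word n (zeta_path T) k) \<longleftrightarrow>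
      (\<forall>k<?h. count_list xs k = count_list ?a k) \<and>
      (\<forall>k. Suc k < ?h \<longrightarrow>
        filter (\<lambda>a. a = k \<or> a = Suc k) xs = filter (\<lambda>a. a = k \<or> a = Suc k) ?a)" for xs
  proof -
    have "(\<forall>k. 1 \<le> k \<and> k < ?h \<longrightarrow> P k) \<longleftrightarrow> (\<forall>k. Suc k < ?h \<longrightarrow> P (Suc k))" for P
      by (metis One_nat_def Suc_le_D Suc_le_mono zero_le)
    then show ?thesis
      by (simp add: count_area_vector depth_count_Suc word Suc_eq_plus1[symmetric]
          del: One_nat_def Suc_eq_plus1)
  qed
  have area: "area_vector n (tree_path T) = ?a"
    by (simp add: n_def area_vector_tree_path)
  have "(THE \<mu>. \<mu> \<in> Dyck n \<and>
      ((\<forall>k<?h. count_list (area_vector n \<mu>) k = count_list ?a k) \<and>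
      (\<forall>k. Suc k < ?h \<longrightarrow> filter (\<lambda>a. a = k \<or> a = Suc k) (area_vector n \<mu>) =
        filter (\<lambda>a. a = k \<or> a = Suc k) ?a))) = tree_path T"
  proof (rule the_equality)
    show "tree_path T \<in> Dyck n \<and>
      ((\<forall>k<?h. count_list (area_vector n (tree_path T)) k = count_list ?a k) \<and>
      (\<forall>k. Suc k < ?h \<longrightarrow> filter (\<lambda>a. a = k \<or> a = Suc k) (area_vector n (tree_path T)) =
        filter (\<lambda>a. a = k \<or> a = Suc k) ?a))"
      using tree_path_in_Dyck[of T] by (simp add: area n_def[symmetric])
  next
    fix \<mu>
    assume \<mu>: "\<mu> \<in> Dyck n \<and>
      ((\<forall>k<?h. count_list (area_vector n \<mu>) k = count_list ?a k) \<and>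
      (\<forall>k. Suc k < ?h \<longrightarrow> filter (\<lambda>a. a = k \<or> a = Suc k) (area_vector n \<mu>) =
        filter (\<lambda>a. a = k \<or> a = Suc k) ?a))"
    then obtain T' where T': "\<mu> = tree_path T'" "length (nonroot_nodes T') = n"
      using Dyck_imp_tree_path by blast
    define a' where "a' = map (\<lambda>u. length u - 1) (rl_nodes T')"
    have area': "area_vector n \<mu> = a'"
      using area_vector_tree_path[of T'] by (simp add: T' a'_def)
    have count: "count_list a' k = count_list ?a k" if "k < ?h" for k
      using \<mu> that by (simp add: area')
    have less: "a < ?h" if "a \<in> set ?a" for a
      using that h length_le_height[of _ T] by (force simp: set_rl_nodes in_nonroot_nodes_iff)
    \<comment> \<open>The prescribed counts of the entries below \<open>?h\<close> already add up to
      the common length of both vectors, which leaves no room for larger entries.\<close>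
    have "length (filter (\<lambda>a. a < ?h) a') = length (filter (\<lambda>a. a < ?h) ?a)"
      by (simp add: length_filter_less_eq_sum count)
    also have "\<dots> = length ?a"
      using less by (metis filter_True)
    also have "\<dots> = length a'"
      using T'(2) by (simp add: a'_def n_def length_nonroot_nodes)
    finally have less': "a < ?h" if "a \<in> set a'" for a
      using that length_filter_less[of a a' "\<lambda>a. a < ?h"] by auto
    have filters: "filter (\<lambda>a. a = k \<or> a = Suc k) a' = filter (\<lambda>a. a = k \<or> a = Suc k) ?a" for k
    proof (cases "Suc k < ?h")
      case True
      then show ?thesis
        using \<mu> by (simp add: area')
    next
      case False
      \<comment> \<open>Now \<open>Suc k\<close> is too large to occur, so the restriction is a
        constant list determined by its count.\<close>
      have "filter (\<lambda>a. a = k \<or> a = Suc k) xs = filter (\<lambda>a. a = k) xs"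
        if "\<And>a. a \<in> set xs \<Longrightarrow> a < ?h" for xs
        using that False by (intro filter_cong) auto
      then have "filter (\<lambda>a. a = k \<or> a = Suc k) xs = replicate (count_list xs k) k"
        if "\<And>a. a \<in> set xs \<Longrightarrow> a < ?h" for xs
        using that by (simp add: filter_eq_replicate)
      moreover have "count_list a' k = count_list ?a k"
      proof (cases "k < ?h")
        case False
        then have "k \<notin> set a'" "k \<notin> set ?a"
          using less less' by blast+
        then show ?thesis
          by (metis count_notin)
      qed (rule count)
      ultimately show ?thesis
        using less less' by metis
    qed
    have slow: "successively (\<lambda>a b. b \<le> Suc a) (map (\<lambda>u. length u - 1) (rl_nodes S))" for S
      unfolding successively_map using rl_nodes_slow by (rule successively_mono) auto
    have "a' = ?a"
      using slow_lists_eq[OF slow slow] filters unfolding a'_def by blast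
    then show "\<mu> = tree_path T"
      using \<mu> tree_path_in_Dyck[of T] area area' by (intro area_vector_inj[of _ n]) (auto simp: n_def)
  qed
  then show ?thesis
    unfolding zeta_inv_def Let_def r differences cond .
qed

theorem mainTheorem4:
  fixes n :: nat
  assumes "n > 0"
  shows "{(\<mu>, steep_path n \<mu>) | \<mu>. \<mu> \<in> Dyck n} \<subseteq> SP n
    \<and> {(bounce_path n \<nu>, \<nu>) | \<nu>. \<nu> \<in> Dyck n} \<subseteq> BP n
    \<and> bij_betw (Gamma n)
        {(\<mu>, steep_path n \<mu>) | \<mu>. \<mu> \<in> Dyck n}
        {(bounce_path n \<nu>, \<nu>) | \<nu>. \<nu> \<in> Dyck n}
    \<and> (\<forall>\<mu> \<in> Dyck n. \<forall>\<nu> \<in> Dyck n.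
        Gamma n (\<mu>, steep_path n \<mu>) = (bounce_path n \<nu>, \<nu>) \<longrightarrow> \<nu> = zeta n \<mu>)"
proof -
  \<comment> \<open>This is the zeta map described through trees; \<open>tree_path_inj\<close> makes
    the chosen tree unique.\<close>
  define F where "F \<mu> = zeta_path (THE T. tree_path T = \<mu>)" for \<mu>
  have F: "F (tree_path T) = zeta_path T" for T
  proof -
    have "(THE T'. tree_path T' = tree_path T) = T"
      by (rule the_equality) (auto intro: tree_path_inj)
    then show ?thesis
      by (simp add: F_def)
  qed
  have F_Dyck: "F \<mu> \<in> Dyck n" and zeta_inv_F: "zeta_inv n (F \<mu>) = \<mu>"
    and F_BP: "(bounce_path n (F \<mu>), F \<mu>) \<in> BP n"
    and Gamma_F: "Gamma n (\<mu>, steep_path n \<mu>) = (bounce_path n (F \<mu>), F \<mu>)"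
    if \<mu>: "\<mu> \<in> Dyck n" for \<mu>
  proof -
    obtain T where T: "\<mu> = tree_path T" "length (nonroot_nodes T) = n"
      using Dyck_imp_tree_path[OF \<mu>] .
    show "F \<mu> \<in> Dyck n" "zeta_inv n (F \<mu>) = \<mu>" "(bounce_path n (F \<mu>), F \<mu>) \<in> BP n"
      using zeta_path_in_Dyck[of T] zeta_inv_zeta_path[of T] bounce_pair_zeta_path_in_BP[of T] assms
      by (simp_all add: T F)
    have "the_inv_into (LAC n) Xi_steep (\<mu>, steep_path n \<mu>) = (T, profile T)"
      unfolding the_inv_into_def
    proof (rule the_equality)
      show "(T, profile T) \<in> LAC n \<and> Xi_steep (T, profile T) = (\<mu>, steep_path n \<mu>)"
        using profile_in_LAC[of T] Xi_steep_profile[of T] by (simp add: T)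
    next
      fix S assume S: "S \<in> LAC n \<and> Xi_steep S = (\<mu>, steep_path n \<mu>)"
      obtain T' \<alpha> where T': "S = (T', \<alpha>)"
        by (cases S)
      have "T' = T \<and> \<alpha> = profile T"
        using S unfolding T' T(1) by (intro Xi_steep_eq_steep_path_imp[of _ _ n]) (simp_all add: T(2))
      then show "S = (T, profile T)"
        by (simp add: T')
    qed
    then show "Gamma n (\<mu>, steep_path n \<mu>) = (bounce_path n (F \<mu>), F \<mu>)"
      using bounce_path_zeta_path[of T] by (simp add: Gamma_def Xi_bounce_profile T F)
  qed
  have inj: "inj_on F (Dyck n)"
    using zeta_inv_F by (metis inj_onI)
  have image: "F ` Dyck n = Dyck n"
    using inj F_Dyck finite_Dyck by (intro endo_inj_surj) auto
  have surj: "\<exists>\<mu>\<in>Dyck n. \<nu> = F \<mu>" if "\<nu> \<in> Dyck n" for \<nu>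
    using that image by blast
  have zeta: "zeta n \<mu> = F \<mu>" if "\<mu> \<in> Dyck n" for \<mu>
  proof -
    \<comment> \<open>As \<open>F\<close> is onto \<open>Dyck n\<close>, its left inverse
      \<open>zeta_inv n\<close> is two-sided there and thus injective, as the evaluation of
      \<open>the_inv_into\<close> requires.\<close>
    have "inj_on (zeta_inv n) (Dyck n)"
      using surj zeta_inv_F by (metis inj_onI)
    then show ?thesis
      unfolding zeta_def using that zeta_inv_F F_Dyck by (intro the_inv_into_f_eq) auto
  qed
  have "bij_betw (Gamma n) {(\<mu>, steep_path n \<mu>) | \<mu>. \<mu> \<in> Dyck n}
      {(bounce_path n \<nu>, \<nu>) | \<nu>. \<nu> \<in> Dyck n}"
  proof (rule bij_betwI')
    fix p q
    assume "p \<in> {(\<mu>, steep_path n \<mu>) | \<mu>. \<mu> \<in> Dyck n}" "q \<in> {(\<mu>, steep_path n \<mu>) | \<mu>. \<mu> \<in> Dyck n}"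
    then show "(Gamma n p = Gamma n q) = (p = q)"
      using inj by (auto simp: Gamma_F dest: inj_onD)
  next
    fix p assume "p \<in> {(\<mu>, steep_path n \<mu>) | \<mu>. \<mu> \<in> Dyck n}"
    then show "Gamma n p \<in> {(bounce_path n \<nu>, \<nu>) | \<nu>. \<nu> \<in> Dyck n}"
      by (auto simp: Gamma_F F_Dyck)
  next
    fix q assume "q \<in> {(bounce_path n \<nu>, \<nu>) | \<nu>. \<nu> \<in> Dyck n}"
    then obtain \<mu> where "\<mu> \<in> Dyck n" "q = (bounce_path n (F \<mu>), F \<mu>)"
      using surj by blast
    then show "\<exists>p\<in>{(\<mu>, steep_path n \<mu>) | \<mu>. \<mu> \<in> Dyck n}. q = Gamma n p"
      by (auto simp: Gamma_F[symmetric])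
  qed
  moreover have "{(\<mu>, steep_path n \<mu>) | \<mu>. \<mu> \<in> Dyck n} \<subseteq> SP n"
    using steep_pair_in_SP by auto
  moreover have "{(bounce_path n \<nu>, \<nu>) | \<nu>. \<nu> \<in> Dyck n} \<subseteq> BP n"
    using surj F_BP by auto
  moreover have "\<forall>\<mu> \<in> Dyck n. \<forall>\<nu> \<in> Dyck n.
        Gamma n (\<mu>, steep_path n \<mu>) = (bounce_path n \<nu>, \<nu>) \<longrightarrow> \<nu> = zeta n \<mu>"
    by (simp add: Gamma_F zeta)
  ultimately show ?thesis
    by blast
qed

end
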